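(* Let $n\ge1$, $\sigma>0$, $\boldsymbol\mu\in\mathcal S_n^\cup$, and observe $\mathbf y=\boldsymbol\mu+\boldsymbol\xi$ with $\boldsymbol\xi\sim\mathcal N(\mathbf 0,\sigma^2 I_{n\times n})$. Let $\hat q=q(\Pi_{\mathcal S_n^\cup}(\mathbf y))$. Then $$\mathbb E_{\boldsymbol\mu}[\hat q]\le 10\,q(\boldsymbol\mu)\log\frac{en}{q(\boldsymbol\mu)}-1.$$ Furthermore, for every $\alpha\in(0,1)$, the statistic $\hat r_\cup=\sigma^2\hat q(20+40\log n+10\log(1/\alpha))/n$ satisfies $$\mathbb E_{\boldsymbol\mu}[\hat r_\cup]\le\frac{\sigma^2q(\boldsymbol\mu)\cdot 10\log(en)\big(20+40\log n+10\log(1/\alpha)\big)}{n}.$$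
   Context: For $n\ge3$, $\mathcal S_n^\cup=\{\mathbf u\in\mathbb R^n:2u_i\le u_{i+1}+u_{i-1},\ i=2,\dots,n-1\}$ (convex sequences); $\mathcal S_1^\cup=\mathbb R$, $\mathcal S_2^\cup=\mathbb R^2$. $\Pi_{\mathcal S_n^\cup}$ is the Euclidean projection onto $\mathcal S_n^\cup$ (the least squares estimator). For $\mathbf u\in\mathcal S_n^\cup$, $q(\mathbf u)$ is one plus the number of strict inequalities $2u_i<u_{i+1}+u_{i-1}$, $i=2,\dots,n-1$, i.e. the minimal number of affine pieces. $\mathbb E_{\boldsymbol\mu}$ is expectation under $\mathbf y=\boldsymbol\mu+\boldsymbol\xi$. *)

theory Defs
  imports "HOL-Probability.Probability"
begin

text \<open>Vectors in R^n are represented as functions nat => real, extensional on {..<n}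
  (coordinates 0..n-1). Paper index i (1-based, i = 2..n-1) corresponds to i-1 here.\<close>

definition convex_seqs :: "nat \<Rightarrow> (nat \<Rightarrow> real) set" where
  "convex_seqs n = {u \<in> extensional {..<n}.
      \<forall>i. 1 \<le> i \<and> i + 1 < n \<longrightarrow> 2 * u i \<le> u (i + 1) + u (i - 1)}"

definition proj_convex :: "nat \<Rightarrow> (nat \<Rightarrow> real) \<Rightarrow> (nat \<Rightarrow> real)" where
  "proj_convex n y = (THE u. u \<in> convex_seqs n \<and>
      (\<forall>v \<in> convex_seqs n. (\<Sum>i<n. (y i - u i)\<^sup>2) \<le> (\<Sum>i<n. (y i - v i)\<^sup>2)))"

text \<open>Minimal number of affine pieces: one plus the number of strict convexity inequalities.\<close>
definition q_pieces :: "nat \<Rightarrow> (nat \<Rightarrow> real) \<Rightarrow> nat" where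
  "q_pieces n u = 1 + card {i. 1 \<le> i \<and> i + 1 < n \<and> 2 * u i < u (i + 1) + u (i - 1)}"

definition noise_measure :: "nat \<Rightarrow> real \<Rightarrow> (nat \<Rightarrow> real) measure" where
  "noise_measure n \<sigma> = PiM {..<n} (\<lambda>_. density lborel (normal_density 0 \<sigma>))"

end

theory Submission
  imports Defs "HOL-Real_Asymp.Real_Asymp"
begin

text \<open>Write \<open>\<Pi>\<close> for the projection and \<open>y = \<mu> + \<xi>\<close>. For small \<open>h\<close> the sum over \<open>i\<close> of the difference
  quotients of \<open>\<Pi>(y)\<^sub>i\<close> in the \<open>i\<close>-th coordinate is at least the dimension of the face of \<open>\<Pi>(y)\<close>, hence at
  least the number of pieces, so Stein's lemma bounds the expected number of pieces by
  \<open>E\<langle>\<xi>, \<Pi>(y)\<rangle> / \<sigma>\<^sup>2 = E\<langle>\<xi>, \<Pi>(y) - \<mu>\<rangle> / \<sigma>\<^sup>2\<close>. The vector \<open>v = \<Pi>(y) - \<mu>\<close> is convex on each affine piece of \<open>\<mu>\<close>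
  and satisfies \<open>|v|\<^sup>2 \<le> \<langle>\<xi>, v\<rangle>\<close>, so it suffices to find, for a block of length \<open>m\<close>, a quadratic form \<open>Q\<close>
  with \<open>\<langle>x, v\<rangle>\<^sup>2 \<le> Q(x) |v|\<^sup>2\<close> for all convex \<open>v\<close> and \<open>E Q(\<xi>) \<le> \<sigma>\<^sup>2 (9 + 8 ln m)\<close>; concavity of the logarithm
  then sums up the blocks.

  To find \<open>Q\<close>, subtract from \<open>v\<close> its minimum and split at the minimiser into a decreasing part \<open>L\<close> and an
  increasing part \<open>R\<close>. With \<open>w\<^sub>j = L\<^sub>j - L\<^sub>j\<^sub>+\<^sub>1\<close>, which is nonnegative and decreasing, summation by parts gives
  \<open>\<langle>x, L\<rangle> = \<Sum> w\<^sub>j S\<^sub>j\<close> with partial sums \<open>S\<^sub>j\<close> of \<open>x\<close>, while \<open>\<Sum> j\<^sup>2 w\<^sub>j\<^sup>2 \<le> |L|\<^sup>2\<close>; by Cauchy--Schwarz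
  \<open>\<langle>x, L\<rangle>\<^sup>2 \<le> |L|\<^sup>2 \<Sum> S\<^sub>j\<^sup>2 / j\<^sup>2\<close>, and the last sum has expectation of harmonic size. The constants are
  treated separately, at the cost of a factor 4, because a nonnegative convex sequence with a zero makes an
  angle of at least 30 degrees with the constants.\<close>

section \<open>Convex sequences and quadratic forms\<close>

lemma sum_mult_tail_sums:
  fixes x w :: "nat \<Rightarrow> real"
  shows "(\<Sum>i<m. x i * (\<Sum>j=i..<m. w j)) = (\<Sum>j<m. w j * (\<Sum>i<Suc j. x i))"
proof (induction m)
  case (Suc m)
  have "(\<Sum>i<Suc m. x i * (\<Sum>j=i..<Suc m. w j))
      = (\<Sum>i<Suc m. x i * (\<Sum>j=i..<m. w j) + x i * w m)"
    by (intro sum.cong) (auto simp: algebra_simps)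
  also have "\<dots> = (\<Sum>i<m. x i * (\<Sum>j=i..<m. w j)) + w m * (\<Sum>i<Suc m. x i)"
    by (simp add: sum.distrib sum_distrib_left algebra_simps)
  finally show ?case using Suc by simp
qed simp

text \<open>Induction on \<open>m\<close>: appending \<open>w m\<close> to every tail adds
  \<open>2 * w m * (\<Sum>i<m. L i) + (m + 1) * (w m)\<^sup>2\<close>. By summation by parts the sum
  of the \<open>L i\<close> is that of \<open>(j + 1) * w j\<close>, hence at least
  \<open>w m * m * (m + 1) / 2\<close> by monotonicity, and the increment is at least
  \<open>((m + 1) * w m)\<^sup>2\<close>.\<close>

lemma sum_squares_tail_sums_ge:
  fixes w :: "nat \<Rightarrow> real"
  assumes "\<And>j. j < m \<Longrightarrow> 0 \<le> w j" and "\<And>i j. i \<le> j \<Longrightarrow> j < m \<Longrightarrow> w j \<le> w i"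
  shows "(\<Sum>j<m. (real (Suc j))\<^sup>2 * (w j)\<^sup>2) \<le> (\<Sum>i<m. (\<Sum>j=i..<m. w j)\<^sup>2)"
  using assms
proof (induction m)
  case (Suc m)
  define L where "L i = (\<Sum>j=i..<m. w j)" for i
  have "(\<Sum>i<Suc m. (\<Sum>j=i..<Suc m. w j)\<^sup>2) = (\<Sum>i<Suc m. (L i + w m)\<^sup>2)"
    by (intro sum.cong) (auto simp: L_def)
  also have "\<dots> = (\<Sum>i<m. (L i)\<^sup>2) + 2 * w m * (\<Sum>i<m. L i) + real (Suc m) * (w m)\<^sup>2"
    by (simp add: power2_sum sum.distrib sum_distrib_left L_def algebra_simps)
  finally have eq: "(\<Sum>i<Suc m. (\<Sum>j=i..<Suc m. w j)\<^sup>2)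
      = (\<Sum>i<m. (L i)\<^sup>2) + 2 * w m * (\<Sum>i<m. L i) + real (Suc m) * (w m)\<^sup>2" .
  have "(\<Sum>i<m. L i) = (\<Sum>j<m. w j * real (Suc j))"
    using sum_mult_tail_sums[where x = "\<lambda>_. 1" and m = m and w = w] by (simp add: L_def)
  also have "\<dots> \<ge> (\<Sum>j<m. w m * real (Suc j))"
    using Suc.prems by (intro sum_mono mult_right_mono) auto
  also have "(\<Sum>j<m. w m * real (Suc j)) = w m * (real m * (real m + 1) / 2)"
  proof -
    have "(\<Sum>j<m. c * real (Suc j)) = c * (real m * (real m + 1) / 2)" for c
      by (induction m) (auto simp: field_simps)
    then show ?thesis .
  qed
  finally have "w m * (w m * (real m * (real m + 1) / 2)) \<le> w m * (\<Sum>i<m. L i)"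
    using Suc.prems by (intro mult_left_mono) auto
  moreover have "(\<Sum>j<m. (real (Suc j))\<^sup>2 * (w j)\<^sup>2) \<le> (\<Sum>i<m. (L i)\<^sup>2)"
    unfolding L_def using Suc.prems by (intro Suc.IH) auto
  ultimately show ?case unfolding eq by (simp add: power2_eq_square algebra_simps)
qed simp

lemma sum_mult_tail_sums_square_le:
  fixes x w :: "nat \<Rightarrow> real"
  assumes "\<And>j. j < m \<Longrightarrow> 0 \<le> w j" and "\<And>i j. i \<le> j \<Longrightarrow> j < m \<Longrightarrow> w j \<le> w i"
  shows "(\<Sum>i<m. x i * (\<Sum>j=i..<m. w j))\<^sup>2
      \<le> (\<Sum>j<m. ((\<Sum>i<Suc j. x i) / real (Suc j))\<^sup>2) * (\<Sum>i<m. (\<Sum>j=i..<m. w j)\<^sup>2)"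
proof -
  have "(\<Sum>i<m. x i * (\<Sum>j=i..<m. w j))
      = (\<Sum>j<m. ((\<Sum>i<Suc j. x i) / real (Suc j)) * (real (Suc j) * w j))"
    unfolding sum_mult_tail_sums by (intro sum.cong) (auto simp del: sum.lessThan_Suc of_nat_Suc)
  then have "(\<Sum>i<m. x i * (\<Sum>j=i..<m. w j))\<^sup>2
      \<le> (\<Sum>j<m. ((\<Sum>i<Suc j. x i) / real (Suc j))\<^sup>2) * (\<Sum>j<m. (real (Suc j) * w j)\<^sup>2)"
    using Cauchy_Schwarz_ineq_sum[of "\<lambda>j. (\<Sum>i<Suc j. x i) / real (Suc j)"
        "\<lambda>j. real (Suc j) * w j" "{..<m}"] by (simp del: sum.lessThan_Suc of_nat_Suc)
  also have "\<dots> \<le> (\<Sum>j<m. ((\<Sum>i<Suc j. x i) / real (Suc j))\<^sup>2) * (\<Sum>i<m. (\<Sum>j=i..<m. w j)\<^sup>2)"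
    unfolding power_mult_distrib using assms
    by (intro mult_left_mono sum_squares_tail_sums_ge sum_nonneg) auto
  finally show ?thesis .
qed

text \<open>For \<open>a j = j\<close> the first claim amounts to
  \<open>4 * p * (p + 1) \<le> (2 * p + 1)\<^sup>2\<close>, so the constant is almost sharp; being
  affine in \<open>p\<close>, it adds up well over the two branches of a convex sequence. The
  trapezoid bound and the sign carry the induction.\<close>

lemma square_sum_convex_from_zero_le:
  fixes a :: "nat \<Rightarrow> real"
  assumes "a 0 = 0" and "\<And>j. j < p \<Longrightarrow> 0 \<le> a (Suc j) - a j"
    and "\<And>i j. i \<le> j \<Longrightarrow> j < p \<Longrightarrow> a (Suc i) - a i \<le> a (Suc j) - a j"
  shows "8 * (\<Sum>j\<le>p. a j)\<^sup>2 \<le> 3 * (2 * real p + 1) * (\<Sum>j\<le>p. (a j)\<^sup>2)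
      \<and> (\<Sum>j\<le>p. a j) \<le> a p * (real p + 1) / 2 \<and> 0 \<le> (\<Sum>j\<le>p. a j)"
  using assms(2,3)
proof (induction p)
  case 0
  then show ?case using assms(1) by simp
next
  case (Suc p)
  define s where "s = (\<Sum>j\<le>p. a j)"
  define Q where "Q = (\<Sum>j\<le>p. (a j)\<^sup>2)"
  define b where "b = a (Suc p)"
  have IH: "8 * s\<^sup>2 \<le> 3 * (2 * real p + 1) * Q" "s \<le> a p * (real p + 1) / 2" "0 \<le> s"
    using Suc by (auto simp: s_def Q_def)
  have "a p = (\<Sum>j<p. a (Suc j) - a j)"
    using assms(1) by (simp add: sum_lessThan_telescope)
  also have "\<dots> \<le> (\<Sum>j<p. b - a p)"
    using Suc.prems by (intro sum_mono) (auto simp: b_def)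
  finally have ap: "a p * (real p + 1) \<le> real p * b" by (simp add: algebra_simps)
  have "0 \<le> a p"
  proof -
    have "a p = (\<Sum>j<p. a (Suc j) - a j)"
      using assms(1) by (simp add: sum_lessThan_telescope)
    also have "\<dots> \<ge> 0" using Suc.prems by (intro sum_nonneg) auto
    finally show ?thesis .
  qed
  then have b0: "0 \<le> b" using Suc.prems(1)[of p] by (simp add: b_def)
  have sb: "s \<le> real p * b / 2" using IH(2) ap by simp
  \<comment> \<open>The increment of the claim from \<open>p\<close> to \<open>Suc p\<close>. After
    multiplication by \<open>2 * p + 1\<close> the induction hypothesis bounds \<open>Q\<close>
    below through \<open>s\<close>; with \<open>t\<close> the shortfall of \<open>s\<close> from the
    trapezoid bound, what remains is a sum of nonnegative terms.\<close>
  have key: "8 * (2 * s * b + b\<^sup>2) \<le> 6 * Q + 3 * (2 * real p + 3) * b\<^sup>2"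
  proof -
    define t where "t = real p * b / 2 - s"
    have "0 \<le> b\<^sup>2 + 16 * (t * b) * (real p + 1) + 16 * t\<^sup>2"
      using sb b0 by (auto simp: t_def intro!: add_nonneg_nonneg mult_nonneg_nonneg)
    also have "\<dots> = 16 * s\<^sup>2 + (2 * real p + 1) * (3 * (2 * real p + 3) * b\<^sup>2)
        - (2 * real p + 1) * 8 * (2 * s * b + b\<^sup>2)"
      unfolding t_def by (simp add: power2_eq_square field_simps)
    finally have "(2 * real p + 1) * 8 * (2 * s * b + b\<^sup>2)
        \<le> 16 * s\<^sup>2 + (2 * real p + 1) * (3 * (2 * real p + 3) * b\<^sup>2)" by simp
    also have "\<dots> \<le> (2 * real p + 1) * (6 * Q + 3 * (2 * real p + 3) * b\<^sup>2)"
      using IH(1) by (simp add: algebra_simps)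
    finally have "(2 * real p + 1) * (8 * (2 * s * b + b\<^sup>2))
        \<le> (2 * real p + 1) * (6 * Q + 3 * (2 * real p + 3) * b\<^sup>2)" by (simp only: mult.assoc)
    then show ?thesis by (rule mult_left_le_imp_le) simp
  qed
  have "8 * (s + b)\<^sup>2 \<le> 3 * (2 * real (Suc p) + 1) * (Q + b\<^sup>2)"
    using key IH(1) by (simp add: power2_eq_square algebra_simps)
  moreover have "s + b \<le> b * (real (Suc p) + 1) / 2"
    using sb by (simp add: algebra_simps add_divide_distrib)
  ultimately show ?case using IH(3) b0 by (simp add: s_def Q_def b_def)
qed

section \<open>The quadratic form bounding inner products with convex sequences\<close>

definition partial_mean_energy :: "nat \<Rightarrow> (nat \<Rightarrow> real) \<Rightarrow> real" where
  "partial_mean_energy m x = (\<Sum>j<m. ((\<Sum>i<Suc j. x i) / real (Suc j))\<^sup>2)"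

definition centred :: "nat \<Rightarrow> (nat \<Rightarrow> real) \<Rightarrow> nat \<Rightarrow> real" where
  "centred m x i = x i - (\<Sum>j<m. x j) / real m"

text \<open>The first term handles the mean of \<open>x\<close>. The centred remainder is read from
  both ends, one direction for each branch of a convex sequence around its minimum; centring
  annihilates the minimum value. The factor 4 is the inverse square of the sine of 30
  degrees.\<close>

definition convex_energy :: "nat \<Rightarrow> (nat \<Rightarrow> real) \<Rightarrow> real" where
  "convex_energy m x = (\<Sum>i<m. x i)\<^sup>2 / real m
     + 4 * (partial_mean_energy m (centred m x)
            + partial_mean_energy m (\<lambda>i. centred m x (m - Suc i)))"

lemma partial_mean_energy_nonneg: "0 \<le> partial_mean_energy m x"
  unfolding partial_mean_energy_def by (intro sum_nonneg) simp

lemma convex_energy_nonneg: "0 \<le> convex_energy m x"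
  unfolding convex_energy_def by (intro add_nonneg_nonneg) (auto simp: partial_mean_energy_nonneg)

text \<open>Convexity without the extensionality of \<open>convex_seqs\<close>, so that it applies
  to shifted blocks, reversals and differences.\<close>

definition convex_upto :: "nat \<Rightarrow> (nat \<Rightarrow> real) \<Rightarrow> bool" where
  "convex_upto m v \<longleftrightarrow> (\<forall>i. 1 \<le> i \<and> i + 1 < m \<longrightarrow> 2 * v i \<le> v (i + 1) + v (i - 1))"

lemma convex_upto_diff_antimono:
  assumes "convex_upto m v" and "i \<le> j" and "Suc j < m"
  shows "v j - v (Suc j) \<le> v i - v (Suc i)"
  using assms(2,3)
proof (induction j rule: dec_induct)
  case (step j)
  have "2 * v (Suc j) \<le> v (Suc (Suc j)) + v j"
    using assms(1) step.prems unfolding convex_upto_def by (auto dest: spec[of _ "Suc j"])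
  with step show ?case by simp
qed simp

lemma convex_upto_reverse:
  assumes "convex_upto m v" shows "convex_upto m (\<lambda>i. v (m - Suc i))"
  unfolding convex_upto_def
proof (intro allI impI)
  fix i assume i: "1 \<le> i \<and> i + 1 < m"
  then have eq: "m - Suc (i - 1) = (m - Suc i) + 1" "m - Suc (i + 1) = (m - Suc i) - 1" by auto
  show "2 * v (m - Suc i) \<le> v (m - Suc (i + 1)) + v (m - Suc (i - 1))"
    using assms i unfolding eq convex_upto_def by (auto dest!: spec[of _ "m - Suc i"])
qed

text \<open>The drops \<open>w\<close> towards the minimiser \<open>k\<close>, continued by zero
  beyond it, are nonnegative and decreasing, and \<open>L\<close> consists of their tail sums; hence
  the first claim. Read from \<open>k\<close> leftwards, \<open>L\<close> starts at zero and has
  nonnegative, nondecreasing increments; hence the second.\<close>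

lemma convex_left_of_min:
  fixes v x :: "nat \<Rightarrow> real"
  assumes cv: "convex_upto m v" and k: "k < m" and min: "\<And>i. i < m \<Longrightarrow> v k \<le> v i"
  defines "L \<equiv> \<lambda>i. if i < k then v i - v k else 0"
  shows "(\<Sum>i<m. x i * L i)\<^sup>2 \<le> partial_mean_energy m x * (\<Sum>i<m. (L i)\<^sup>2)"
    and "8 * (\<Sum>i<m. L i)\<^sup>2 \<le> 3 * (2 * real k + 1) * (\<Sum>i<m. (L i)\<^sup>2)"
proof -
  define w where "w j = (if j < k then v j - v (Suc j) else 0)" for j
  have w0: "0 \<le> w j" for j
  proof (cases "j < k")
    case True
    have "v (k - 1) - v (Suc (k - 1)) \<le> v j - v (Suc j)"
      using True k by (intro convex_upto_diff_antimono[OF cv]) auto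
    moreover have "v k \<le> v (k - 1)" using min[of "k - 1"] k by simp
    ultimately show ?thesis using True by (simp add: w_def)
  qed (simp add: w_def)
  have anti: "w j \<le> w i" if "i \<le> j" for i j
  proof (cases "j < k")
    case True
    then show ?thesis using convex_upto_diff_antimono[OF cv, of i j] that k by (simp add: w_def)
  qed (use w0[of i] in \<open>simp add: w_def\<close>)
  have L: "(\<Sum>j=i..<m. w j) = L i" for i
  proof (cases "i < k")
    case True
    have "(\<Sum>j=i..<m. w j) = (\<Sum>j=i..<k. v j - v (Suc j))"
      using True k by (intro sum.mono_neutral_cong_right) (auto simp: w_def)
    also have "\<dots> = v i - v k"
      using True sum_Suc_diff'[of i k "\<lambda>j. - v j"] by simp
    finally show ?thesis using True by (simp add: L_def)
  qed (simp add: w_def L_def)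
  show "(\<Sum>i<m. x i * L i)\<^sup>2 \<le> partial_mean_energy m x * (\<Sum>i<m. (L i)\<^sup>2)"
    using sum_mult_tail_sums_square_le[of m w x] w0 anti by (simp only: L partial_mean_energy_def)
  define a where "a j = v (k - j) - v k" for j
  have shift: "(\<Sum>i<m. f (L i)) = (\<Sum>j\<le>k. f (a j))" if "f 0 = 0" for f :: "real \<Rightarrow> real"
  proof -
    have "(\<Sum>i<m. f (L i)) = (\<Sum>i<k. f (v i - v k))"
      using k that by (intro sum.mono_neutral_cong_right) (auto simp: L_def)
    also have "\<dots> = (\<Sum>i<k. f (a (Suc i)))"
      using sum.nat_diff_reindex[of "\<lambda>i. f (v i - v k)" k] by (simp add: a_def)
    also have "\<dots> = (\<Sum>j\<le>k. f (a j))"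
      using that by (simp add: sum.atMost_shift a_def)
    finally show ?thesis .
  qed
  have inc: "a (Suc j) - a j = w (k - Suc j)" if "j < k" for j
    using that by (simp add: a_def w_def Suc_diff_Suc)
  have "8 * (\<Sum>j\<le>k. a j)\<^sup>2 \<le> 3 * (2 * real k + 1) * (\<Sum>j\<le>k. (a j)\<^sup>2)"
    by (rule conjunct1[OF square_sum_convex_from_zero_le]) (auto simp: inc w0 intro!: anti, simp add: a_def)
  then show "8 * (\<Sum>i<m. L i)\<^sup>2 \<le> 3 * (2 * real k + 1) * (\<Sum>i<m. (L i)\<^sup>2)"
    using shift[of "\<lambda>x. x"] shift[of "\<lambda>x. x\<^sup>2"] by simp
qed

text \<open>A two-term Cauchy--Schwarz inequality in which \<open>a\<close> and \<open>b\<close> are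
  known only through bounds on their squares; the cross term \<open>2 * (a * b)\<close> is at most
  \<open>A * D + C * B\<close> by the inequality of arithmetic and geometric means.\<close>

lemma add_mult_square_le:
  fixes a b c d :: real
  assumes "a\<^sup>2 \<le> A * B" "b\<^sup>2 \<le> C * D" "0 \<le> A" "0 \<le> B" "0 \<le> C" "0 \<le> D"
  shows "(a + b)\<^sup>2 \<le> (A + C) * (B + D)"
proof -
  have "(a * b)\<^sup>2 \<le> (A * B) * (C * D)"
    unfolding power_mult_distrib using assms by (intro mult_mono) auto
  also have "\<dots> = (sqrt (A * D) * sqrt (C * B))\<^sup>2"
    using assms by (simp add: power_mult_distrib mult_ac)
  finally have "\<bar>a * b\<bar> \<le> sqrt (A * D) * sqrt (C * B)"
    using assms by (simp add: abs_le_square_iff[symmetric])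
  moreover have "2 * (sqrt (A * D) * sqrt (C * B)) \<le> A * D + C * B"
    using sum_squares_bound[of "sqrt (A * D)" "sqrt (C * B)"] assms by (simp add: mult.assoc)
  ultimately have "2 * (a * b) \<le> A * D + C * B" by linarith
  then show ?thesis using assms(1,2) by (simp add: power2_eq_square algebra_simps)
qed

lemma convex_upto_inner_square_le:
  assumes cv: "convex_upto m v"
  shows "(\<Sum>i<m. x i * v i)\<^sup>2 \<le> convex_energy m x * (\<Sum>i<m. (v i)\<^sup>2)"
proof (cases "m = 0")
  case False
  then have m: "0 < m" by simp
  obtain k where k: "k < m" and min: "\<And>i. i < m \<Longrightarrow> v k \<le> v i"
  proof -
    have "finite (v ` {..<m})" "v ` {..<m} \<noteq> {}" using m by auto
    from Min_in[OF this] obtain k where "k < m" "v k = Min (v ` {..<m})" by auto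
    then show ?thesis using that by auto
  qed
  define c where "c = centred m x"
  define u where "u i = v i - v k" for i
  define L where "L i = (if i < k then v i - v k else 0)" for i
  \<comment> \<open>The right branch is stored reflected, so that it is a left branch of the
    reversed sequence, whose minimiser is \<open>m - Suc k\<close>.\<close>
  define R where "R i = (if i < m - Suc k then v (m - Suc i) - v (m - Suc (m - Suc k)) else 0)" for i
  have rev: "(\<Sum>i<m. f (m - Suc i)) = (\<Sum>i<m. f i)" for f :: "nat \<Rightarrow> real"
    by (rule sum.nat_diff_reindex)
  have uLR: "u i = L i + R (m - Suc i)" and LR: "L i * R (m - Suc i) = 0" if "i < m" for i
  proof -
    consider "i < k" | "i = k" | "k < i" by linarith
    then show "u i = L i + R (m - Suc i)" and "L i * R (m - Suc i) = 0"
      using that k by (cases; auto simp: u_def L_def R_def Suc_diff_Suc)+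
  qed
  have Lx: "(\<Sum>i<m. x i * L i)\<^sup>2 \<le> partial_mean_energy m x * (\<Sum>i<m. (L i)\<^sup>2)" for x
    using convex_left_of_min(1)[OF cv k min] unfolding L_def by auto
  have L1: "8 * (\<Sum>i<m. L i)\<^sup>2 \<le> 3 * (2 * real k + 1) * (\<Sum>i<m. (L i)\<^sup>2)"
    using convex_left_of_min(2)[OF cv k min] unfolding L_def by auto
  have Rx: "(\<Sum>i<m. x i * R i)\<^sup>2 \<le> partial_mean_energy m x * (\<Sum>i<m. (R i)\<^sup>2)" for x
    using convex_left_of_min(1)[OF convex_upto_reverse[OF cv], of "m - Suc k"] min k m
    unfolding R_def by auto
  have R1: "8 * (\<Sum>i<m. R i)\<^sup>2 \<le> 3 * (2 * real (m - Suc k) + 1) * (\<Sum>i<m. (R i)\<^sup>2)"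
    using convex_left_of_min(2)[OF convex_upto_reverse[OF cv], of "m - Suc k"] min k m
    unfolding R_def by auto
  have u2: "(\<Sum>i<m. (u i)\<^sup>2) = (\<Sum>i<m. (L i)\<^sup>2) + (\<Sum>i<m. (R i)\<^sup>2)"
  proof -
    have "(\<Sum>i<m. (u i)\<^sup>2) = (\<Sum>i<m. (L i)\<^sup>2 + (R (m - Suc i))\<^sup>2)"
      using uLR LR by (intro sum.cong) (auto simp: power2_sum)
    then show ?thesis using rev[of "\<lambda>i. (R i)\<^sup>2"] by (simp add: sum.distrib)
  qed
  have cu: "(\<Sum>i<m. c i * u i)\<^sup>2 \<le>
      (partial_mean_energy m c + partial_mean_energy m (\<lambda>i. c (m - Suc i))) * (\<Sum>i<m. (u i)\<^sup>2)"
  proof -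
    have "(\<Sum>i<m. c i * u i) = (\<Sum>i<m. c i * L i) + (\<Sum>i<m. c i * R (m - Suc i))"
      unfolding sum.distrib[symmetric] by (intro sum.cong) (auto simp: uLR algebra_simps)
    also have "(\<Sum>i<m. c i * R (m - Suc i)) = (\<Sum>i<m. c (m - Suc i) * R i)"
      unfolding rev[of "\<lambda>i. c (m - Suc i) * R i", symmetric]
      by (auto simp: Suc_diff_Suc intro: sum.cong)
    finally show ?thesis unfolding u2
      by (simp only:) (intro add_mult_square_le Lx Rx partial_mean_energy_nonneg sum_nonneg, auto)
  qed
  \<comment> \<open>The constant direction carries at most three quarters of the energy of
    \<open>u\<close>: the two branch constants add up exactly to \<open>3 / 4 * m\<close>, wherever
    the minimiser lies.\<close>
  have u1: "(\<Sum>i<m. u i)\<^sup>2 \<le> 3 / 4 * real m * (\<Sum>i<m. (u i)\<^sup>2)"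
  proof -
    have "(\<Sum>i<m. u i) = (\<Sum>i<m. L i) + (\<Sum>i<m. R i)"
      using rev[of R] by (simp add: uLR sum.distrib)
    moreover have "((\<Sum>i<m. L i) + (\<Sum>i<m. R i))\<^sup>2 \<le>
      (3 / 8 * (2 * real k + 1) + 3 / 8 * (2 * real (m - Suc k) + 1)) * (\<Sum>i<m. (u i)\<^sup>2)"
      unfolding u2 using L1 R1 by (intro add_mult_square_le sum_nonneg) (auto simp del: of_nat_diff)
    moreover have "3 / 8 * (2 * real k + 1) + 3 / 8 * (2 * real (m - Suc k) + 1) = 3 / 4 * real m"
      using k by (simp add: of_nat_diff field_simps)
    ultimately show ?thesis by (simp only:)
  qed
  have sv: "(\<Sum>i<m. v i) = (\<Sum>i<m. u i) + real m * v k"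
    by (simp add: u_def sum_subtractf)
  have v2: "(\<Sum>i<m. (v i)\<^sup>2) = (\<Sum>i<m. (u i)\<^sup>2) + 2 * v k * (\<Sum>i<m. u i) + real m * (v k)\<^sup>2"
  proof -
    have "(\<Sum>i<m. (v i)\<^sup>2) = (\<Sum>i<m. (u i)\<^sup>2 + 2 * v k * u i + (v k)\<^sup>2)"
      by (intro sum.cong) (auto simp: u_def power2_eq_square algebra_simps)
    then show ?thesis by (simp add: sum.distrib sum_distrib_left)
  qed
  \<comment> \<open>\<open>u\<close> and \<open>v\<close> differ by a constant, so they have the
    same centred energy, which is at least a quarter of the energy of \<open>u\<close> by
    \<open>u1\<close>.\<close>
  have var: "(\<Sum>i<m. v i)\<^sup>2 / real m + (\<Sum>i<m. (u i)\<^sup>2) / 4 \<le> (\<Sum>i<m. (v i)\<^sup>2)"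
    using u1 m unfolding sv v2 by (simp add: power2_eq_square field_simps)
  have c0: "(\<Sum>i<m. c i) = 0"
    using m by (simp add: c_def centred_def sum_subtractf)
  have "(\<Sum>i<m. x i * v i) = (\<Sum>i<m. (\<Sum>j<m. x j) / real m * v i + (c i * u i + v k * c i))"
    by (intro sum.cong) (auto simp: c_def centred_def u_def algebra_simps diff_divide_distrib)
  also have "\<dots> = (\<Sum>j<m. x j) / real m * (\<Sum>i<m. v i) + (\<Sum>i<m. c i * u i)"
    unfolding sum.distrib sum_distrib_left[symmetric] c0 by simp
  also have "\<dots>\<^sup>2 \<le> convex_energy m x * ((\<Sum>i<m. v i)\<^sup>2 / real m + (\<Sum>i<m. (u i)\<^sup>2) / 4)"
    unfolding convex_energy_def
    by (intro add_mult_square_le)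
      (use cu m in \<open>auto simp: c_def power_divide power_mult_distrib field_simps power2_eq_square
        intro!: sum_nonneg add_nonneg_nonneg partial_mean_energy_nonneg\<close>)
  also have "\<dots> \<le> convex_energy m x * (\<Sum>i<m. (v i)\<^sup>2)"
    by (intro mult_left_mono var convex_energy_nonneg)
  finally show ?thesis .
qed (simp add: convex_energy_def)

section \<open>The projection onto convex sequences\<close>

lemma convex_seqs_iff: "u \<in> convex_seqs n \<longleftrightarrow> u \<in> extensional {..<n} \<and> convex_upto n u"
  by (simp add: convex_seqs_def convex_upto_def)

lemma convex_upto_cong:
  assumes "\<And>i. i < n \<Longrightarrow> u i = v i" shows "convex_upto n u \<longleftrightarrow> convex_upto n v"
  unfolding convex_upto_def using assms by (intro all_cong1) auto

lemma restrict_in_convex_seqs: "convex_upto n u \<Longrightarrow> restrict u {..<n} \<in> convex_seqs n"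
  unfolding convex_seqs_iff using convex_upto_cong[of n u "restrict u {..<n}"] by simp

lemma convex_upto_combine:
  assumes "convex_upto n u" "convex_upto n v" "0 \<le> s" "0 \<le> t"
  shows "convex_upto n (\<lambda>i. s * u i + t * v i)"
  unfolding convex_upto_def
proof (intro allI impI)
  fix i assume i: "1 \<le> i \<and> i + 1 < n"
  have "s * (2 * u i) + t * (2 * v i) \<le> s * (u (i + 1) + u (i - 1)) + t * (v (i + 1) + v (i - 1))"
    using assms i unfolding convex_upto_def by (intro add_mono mult_left_mono) auto
  then show "2 * (s * u i + t * v i) \<le> s * u (i + 1) + t * v (i + 1) + (s * u (i - 1) + t * v (i - 1))"
    by (simp add: algebra_simps)
qed

text \<open>The midpoint of \<open>u\<close> and \<open>v\<close> is again convex, and the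
  parallelogram identity turns near-optimality of both into closeness. This serves existence,
  through Cauchy sequences, and also uniqueness, with \<open>I\<close> the minimum.\<close>

lemma convex_seqs_min_parallelogram:
  fixes y :: "nat \<Rightarrow> real"
  assumes "u \<in> convex_seqs n" "v \<in> convex_seqs n"
    and I: "\<And>w. w \<in> convex_seqs n \<Longrightarrow> I \<le> (\<Sum>i<n. (y i - w i)\<^sup>2)"
  shows "(\<Sum>i<n. (u i - v i)\<^sup>2) \<le> 2 * (\<Sum>i<n. (y i - u i)\<^sup>2) + 2 * (\<Sum>i<n. (y i - v i)\<^sup>2) - 4 * I"
proof -
  define w where "w = restrict (\<lambda>i. 1/2 * u i + 1/2 * v i) {..<n}"
  have "w \<in> convex_seqs n"
    unfolding w_def using assms by (intro restrict_in_convex_seqs convex_upto_combine) (auto simp: convex_seqs_iff)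
  then have "I \<le> (\<Sum>i<n. (y i - w i)\<^sup>2)" by (rule I)
  moreover have "4 * (\<Sum>i<n. (y i - w i)\<^sup>2) + (\<Sum>i<n. (u i - v i)\<^sup>2)
      = 2 * (\<Sum>i<n. (y i - u i)\<^sup>2) + 2 * (\<Sum>i<n. (y i - v i)\<^sup>2)"
    unfolding sum_distrib_left sum.distrib[symmetric] w_def
    by (intro sum.cong) (auto simp: power2_eq_square field_simps)
  ultimately show ?thesis by simp
qed

text \<open>By the parallelogram bound a minimising sequence is Cauchy in each coordinate; convexity
  is a closed condition and the distance is continuous, so the limit attains the infimum.\<close>

lemma convex_seqs_closest_exists:
  "\<exists>u \<in> convex_seqs n. \<forall>v \<in> convex_seqs n. (\<Sum>i<n. (y i - u i)\<^sup>2) \<le> (\<Sum>i<n. (y i - v i)\<^sup>2)"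
proof -
  define D where "D v = (\<Sum>i<n. (y i - v i)\<^sup>2)" for v :: "nat \<Rightarrow> real"
  define I where "I = Inf (D ` convex_seqs n)"
  have ne: "D ` convex_seqs n \<noteq> {}"
    using restrict_in_convex_seqs[of n "\<lambda>_. 0"] by (auto simp: convex_upto_def)
  have bdd: "bdd_below (D ` convex_seqs n)"
    by (rule bdd_belowI2[of _ 0]) (auto simp: D_def intro!: sum_nonneg)
  have I: "I \<le> D v" if "v \<in> convex_seqs n" for v
    unfolding I_def using bdd that by (intro cInf_lower) auto
  have "\<exists>u \<in> convex_seqs n. D u < I + inverse (real (Suc k))" for k
    using cInf_lessD[OF ne, of "I + inverse (real (Suc k))"] by (auto simp: I_def)
  then obtain u where u: "\<And>k. u k \<in> convex_seqs n" "\<And>k. D (u k) < I + inverse (real (Suc k))"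
    by metis
  have close: "(u k i - u l i)\<^sup>2 \<le> 2 * inverse (real (Suc k)) + 2 * inverse (real (Suc l))"
    if "i < n" for i k l
  proof -
    have "(u k i - u l i)\<^sup>2 \<le> (\<Sum>i<n. (u k i - u l i)\<^sup>2)"
      using that by (intro member_le_sum) auto
    also have "\<dots> \<le> 2 * D (u k) + 2 * D (u l) - 4 * I"
      unfolding D_def by (intro convex_seqs_min_parallelogram u I[unfolded D_def])
    finally show ?thesis using u(2)[of k] u(2)[of l] by linarith
  qed
  have "convergent (\<lambda>k. u k i)" if i: "i < n" for i
  proof -
    have "Cauchy (\<lambda>k. u k i)"
    proof (rule metric_CauchyI)
      fix e :: real assume e: "0 < e"
      obtain N where N: "inverse (real (Suc N)) < e\<^sup>2 / 4"
        using reals_Archimedean[of "e\<^sup>2 / 4"] e by auto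
      have "dist (u k i) (u l i) < e" if "k \<ge> N" "l \<ge> N" for k l
      proof -
        have "inverse (real (Suc k)) \<le> inverse (real (Suc N))" "inverse (real (Suc l)) \<le> inverse (real (Suc N))"
          using that by (auto intro!: le_imp_inverse_le)
        then have "(u k i - u l i)\<^sup>2 < e\<^sup>2" using close[OF i, of k l] N by linarith
        then show ?thesis using e by (metis abs_le_square_iff abs_of_pos dist_real_def not_le)
      qed
      then show "\<exists>M. \<forall>k\<ge>M. \<forall>l\<ge>M. dist (u k i) (u l i) < e" by blast
    qed
    then show ?thesis by (rule real_Cauchy_convergent)
  qed
  then obtain a where a: "\<And>i. i < n \<Longrightarrow> (\<lambda>k. u k i) \<longlonglongrightarrow> a i"
    unfolding convergent_def by metis
  have "convex_upto n a"
    unfolding convex_upto_def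
  proof (intro allI impI)
    fix i assume i: "1 \<le> i \<and> i + 1 < n"
    show "2 * a i \<le> a (i + 1) + a (i - 1)"
    proof (rule LIMSEQ_le)
      show "(\<lambda>k. 2 * u k i) \<longlonglongrightarrow> 2 * a i" using i by (intro tendsto_intros a) auto
      show "(\<lambda>k. u k (i + 1) + u k (i - 1)) \<longlonglongrightarrow> a (i + 1) + a (i - 1)"
        using i by (intro tendsto_intros a) auto
      show "\<exists>N. \<forall>k\<ge>N. 2 * u k i \<le> u k (i + 1) + u k (i - 1)"
        using u(1) i unfolding convex_seqs_def by auto
    qed
  qed
  moreover have "D (restrict a {..<n}) \<le> I"
  proof (rule LIMSEQ_le)
    show "(\<lambda>k. D (u k)) \<longlonglongrightarrow> D (restrict a {..<n})"
      unfolding D_def by (intro tendsto_intros) (use a in auto)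
    show "(\<lambda>k. I + inverse (real (Suc k))) \<longlonglongrightarrow> I"
      using tendsto_add[OF tendsto_const LIMSEQ_inverse_real_of_nat, of I] by simp
  qed (use u(2) less_imp_le in blast)
  ultimately show ?thesis
    using I unfolding D_def by (intro bexI[of _ "restrict a {..<n}"] restrict_in_convex_seqs) (auto intro: order_trans)
qed

text \<open>Existence with uniqueness makes the \<open>THE\<close> in \<open>proj_convex\<close>
  denote; two minimisers are at distance zero, and extensionality makes them equal as
  functions.\<close>

lemma proj_convex_closest:
  shows "proj_convex n y \<in> convex_seqs n"
    and "v \<in> convex_seqs n \<Longrightarrow> (\<Sum>i<n. (y i - proj_convex n y i)\<^sup>2) \<le> (\<Sum>i<n. (y i - v i)\<^sup>2)"
proof -
  have "\<exists>!u. u \<in> convex_seqs n \<and>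
      (\<forall>v \<in> convex_seqs n. (\<Sum>i<n. (y i - u i)\<^sup>2) \<le> (\<Sum>i<n. (y i - v i)\<^sup>2))"
  proof (rule ex_ex1I)
    show "\<exists>u. u \<in> convex_seqs n \<and>
      (\<forall>v \<in> convex_seqs n. (\<Sum>i<n. (y i - u i)\<^sup>2) \<le> (\<Sum>i<n. (y i - v i)\<^sup>2))"
      using convex_seqs_closest_exists[of n y] by blast
  next
    fix u v
    assume u: "u \<in> convex_seqs n \<and>
      (\<forall>v \<in> convex_seqs n. (\<Sum>i<n. (y i - u i)\<^sup>2) \<le> (\<Sum>i<n. (y i - v i)\<^sup>2))"
    assume v: "v \<in> convex_seqs n \<and>
      (\<forall>u \<in> convex_seqs n. (\<Sum>i<n. (y i - v i)\<^sup>2) \<le> (\<Sum>i<n. (y i - u i)\<^sup>2))"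
    have "(\<Sum>i<n. (u i - v i)\<^sup>2) \<le> 2 * (\<Sum>i<n. (y i - u i)\<^sup>2) + 2 * (\<Sum>i<n. (y i - v i)\<^sup>2)
        - 4 * (\<Sum>i<n. (y i - u i)\<^sup>2)"
      using u v by (intro convex_seqs_min_parallelogram) auto
    also have "\<dots> \<le> 0" using u v by (simp add: order_antisym)
    finally have "(\<Sum>i<n. (u i - v i)\<^sup>2) = 0" by (intro antisym sum_nonneg) auto
    then have "\<forall>i<n. u i = v i" by (auto simp: sum_nonneg_eq_0_iff)
    then show "u = v"
      using u v by (intro extensionalityI[of _ "{..<n}"]) (auto simp: convex_seqs_iff)
  qed
  from theI'[OF this] show "proj_convex n y \<in> convex_seqs n"
    and "v \<in> convex_seqs n \<Longrightarrow> (\<Sum>i<n. (y i - proj_convex n y i)\<^sup>2) \<le> (\<Sum>i<n. (y i - v i)\<^sup>2)"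
    unfolding proj_convex_def by auto
qed

section \<open>Variational inequality and nonexpansiveness\<close>

lemma proj_convex_upto: "convex_upto n (proj_convex n y)"
  using proj_convex_closest(1)[of n y] by (simp add: convex_seqs_iff)

lemma proj_convex_variational:
  assumes "convex_upto n w"
  shows "(\<Sum>i<n. (y i - proj_convex n y i) * (w i - proj_convex n y i)) \<le> 0"
proof (rule ccontr)
  define p where "p = proj_convex n y"
  define S where "S = (\<Sum>i<n. (y i - p i) * (w i - p i))"
  define N where "N = (\<Sum>i<n. (w i - p i)\<^sup>2)"
  assume "\<not> (\<Sum>i<n. (y i - proj_convex n y i) * (w i - proj_convex n y i)) \<le> 0"
  then have S: "0 < S" by (simp add: S_def p_def)
  have N: "0 \<le> N" unfolding N_def by (intro sum_nonneg) auto
  \<comment> \<open>Moving from \<open>p\<close> towards \<open>w\<close> by \<open>t\<close>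
    changes the objective by \<open>t\<^sup>2 * N - 2 * t * S\<close>. This choice lies in the unit
    interval and keeps \<open>t * N \<le> S\<close>, so the objective would drop below its
    minimum.\<close>
  define t where "t = S / (S + N)"
  have t: "0 < t" "t \<le> 1" using S N by (auto simp: t_def)
  have "(\<Sum>i<n. (y i - p i)\<^sup>2) \<le> (\<Sum>i<n. (y i - restrict (\<lambda>i. (1 - t) * p i + t * w i) {..<n} i)\<^sup>2)"
    unfolding p_def using t assms
    by (intro proj_convex_closest restrict_in_convex_seqs convex_upto_combine proj_convex_upto) auto
  also have "\<dots> = (\<Sum>i<n. (y i - p i)\<^sup>2 - 2 * t * ((y i - p i) * (w i - p i)) + t\<^sup>2 * (w i - p i)\<^sup>2)"
    by (intro sum.cong) (auto simp: power2_eq_square algebra_simps)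
  also have "\<dots> = (\<Sum>i<n. (y i - p i)\<^sup>2) - 2 * t * S + t\<^sup>2 * N"
    by (simp add: sum.distrib sum_subtractf sum_distrib_left S_def N_def)
  finally have "t * (2 * S) \<le> t * (t * N)" by (simp add: power2_eq_square)
  then have "2 * S \<le> t * N" using t by simp
  also have "t * N \<le> S" using S N by (simp add: t_def field_simps)
  finally show False using S by simp
qed

text \<open>The sum of the variational inequalities at \<open>y\<close> and at \<open>z\<close>,
  each tested with the projection of the other vector.\<close>

lemma proj_convex_firmly_nonexpansive:
  "(\<Sum>i<n. (proj_convex n z i - proj_convex n y i)\<^sup>2)
    \<le> (\<Sum>i<n. (z i - y i) * (proj_convex n z i - proj_convex n y i))"
proof -
  define p q where "p = proj_convex n y" and "q = proj_convex n z"
  have "0 \<ge> (\<Sum>i<n. (y i - p i) * (q i - p i)) + (\<Sum>i<n. (z i - q i) * (p i - q i))"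
    using proj_convex_variational[OF proj_convex_upto[of n z], of y]
      proj_convex_variational[OF proj_convex_upto[of n y], of z] by (simp add: p_def q_def)
  also have "(\<Sum>i<n. (y i - p i) * (q i - p i)) + (\<Sum>i<n. (z i - q i) * (p i - q i))
      = (\<Sum>i<n. (q i - p i)\<^sup>2) - (\<Sum>i<n. (z i - y i) * (q i - p i))"
    unfolding sum_subtractf[symmetric] sum.distrib[symmetric]
    by (intro sum.cong) (auto simp: power2_eq_square algebra_simps)
  finally show ?thesis by (simp add: p_def q_def)
qed

lemma proj_convex_nonexpansive:
  "(\<Sum>i<n. (proj_convex n z i - proj_convex n y i)\<^sup>2) \<le> (\<Sum>i<n. (z i - y i)\<^sup>2)"
proof -
  define d where "d i = proj_convex n z i - proj_convex n y i" for i
  have "2 * (\<Sum>i<n. (d i)\<^sup>2) \<le> (\<Sum>i<n. 2 * ((z i - y i) * d i))"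
    using proj_convex_firmly_nonexpansive[of n z y] by (simp add: d_def sum_distrib_left[symmetric])
  also have "\<dots> \<le> (\<Sum>i<n. (z i - y i)\<^sup>2 + (d i)\<^sup>2)"
    using sum_squares_bound by (intro sum_mono) (auto simp: mult.assoc)
  finally show ?thesis by (simp add: sum.distrib d_def)
qed

text \<open>Passing from the Euclidean norm to the sum of absolute values loses nothing when a
  single coordinate changes, and the sum integrates term by term.\<close>

lemma proj_convex_coordinate_lipschitz:
  assumes "i < n"
  shows "\<bar>proj_convex n z i - proj_convex n y i\<bar> \<le> (\<Sum>i<n. \<bar>z i - y i\<bar>)"
proof -
  have "(proj_convex n z i - proj_convex n y i)\<^sup>2 \<le> (\<Sum>i<n. (proj_convex n z i - proj_convex n y i)\<^sup>2)"
    using assms by (intro member_le_sum) auto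
  also have "\<dots> \<le> (\<Sum>i<n. (\<bar>z i - y i\<bar>)\<^sup>2)" using proj_convex_nonexpansive[of n z y] by simp
  also have "\<dots> \<le> (\<Sum>i<n. \<bar>z i - y i\<bar>)\<^sup>2"
    by (induction n) (auto simp: power2_sum intro!: sum_nonneg add_increasing2 mult_nonneg_nonneg)
  finally show ?thesis
    by (metis abs_le_square_iff abs_of_nonneg sum_nonneg abs_ge_zero)
qed

text \<open>For convex \<open>p\<close> this is the lineality space of the tangent cone at
  \<open>p\<close>, equivalently the span of the face of \<open>p\<close>.\<close>

definition lineality :: "nat \<Rightarrow> (nat \<Rightarrow> real) \<Rightarrow> (nat \<Rightarrow> real) \<Rightarrow> bool" where
  "lineality n p w \<longleftrightarrow> (\<forall>i. 1 \<le> i \<and> i + 1 < n \<and> 2 * p i = p (i + 1) + p (i - 1)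
      \<longrightarrow> 2 * w i = w (i + 1) + w (i - 1))"

text \<open>Where \<open>p\<close> is strictly convex there is slack for a small multiple of
  \<open>w\<close>; elsewhere the second difference of \<open>w\<close> vanishes together with that
  of \<open>p\<close>.\<close>

lemma convex_upto_perturb:
  assumes "convex_upto n p" and "lineality n p w"
  obtains s where "0 < s" and "convex_upto n (\<lambda>i. p i + s * w i)" and "convex_upto n (\<lambda>i. p i - s * w i)"
proof -
  define g where "g i = p (i + 1) + p (i - 1) - 2 * p i" for i
  define e where "e i = w (i + 1) + w (i - 1) - 2 * w i" for i
  \<comment> \<open>An admissible step for each index. The \<open>+ 1\<close> keeps the denominator
    positive, and the 1 inserted into the minimum covers an empty index set.\<close>
  define r where "r i = (if 0 < g i then g i / (\<bar>e i\<bar> + 1) else 1)" for i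
  define s where "s = Min (insert 1 (r ` {..<n}))"
  have r: "0 < r i" for i by (auto simp: r_def intro!: divide_pos_pos)
  have s: "0 < s" unfolding s_def using r by (subst Min_gr_iff) auto
  have le: "s * \<bar>e i\<bar> \<le> g i" if i: "1 \<le> i \<and> i + 1 < n" for i
  proof (cases "0 < g i")
    case True
    have "s \<le> r i" unfolding s_def using i by (intro Min_le) auto
    then have "s * \<bar>e i\<bar> \<le> r i * \<bar>e i\<bar>" by (intro mult_right_mono) auto
    also have "\<dots> \<le> g i" using True by (simp add: r_def field_simps)
    finally show ?thesis .
  next
    case False
    then have "g i = 0" using assms(1) i unfolding convex_upto_def g_def by fastforce
    moreover have "e i = 0" using assms(2) i \<open>g i = 0\<close> unfolding lineality_def g_def e_def by fastforce
    ultimately show ?thesis by simp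
  qed
  have "- g i \<le> s * e i" "s * e i \<le> g i" if "1 \<le> i \<and> i + 1 < n" for i
    using le[OF that] s by (auto simp: abs_if mult_less_0_iff split: if_splits) (smt (verit) mult_nonneg_nonneg mult_nonneg_nonpos)+
  then have "convex_upto n (\<lambda>i. p i + s * w i)" "convex_upto n (\<lambda>i. p i - s * w i)"
    unfolding convex_upto_def g_def e_def by (force simp: algebra_simps)+
  with s that show ?thesis by blast
qed

text \<open>The variational inequality may be tested with both \<open>p + s * w\<close> and
  \<open>p - s * w\<close>, which forces equality.\<close>

lemma proj_convex_residual_orthogonal:
  assumes "lineality n (proj_convex n y) w"
  shows "(\<Sum>i<n. (y i - proj_convex n y i) * w i) = 0"
proof -
  define p where "p = proj_convex n y"
  obtain s where s: "0 < s" "convex_upto n (\<lambda>i. p i + s * w i)" "convex_upto n (\<lambda>i. p i - s * w i)"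
    using convex_upto_perturb[OF proj_convex_upto assms] by (auto simp: p_def)
  have "s * (\<Sum>i<n. (y i - p i) * w i) \<le> 0" "- (s * (\<Sum>i<n. (y i - p i) * w i)) \<le> 0"
    using proj_convex_variational[OF s(2), of y] proj_convex_variational[OF s(3), of y]
    by (simp_all add: p_def sum_distrib_left sum_negf[symmetric] mult_ac)
  then show ?thesis using s(1) by (simp add: p_def mult_le_0_iff zero_le_mult_iff)
qed

section \<open>Difference quotients of the projection\<close>

definition kinks :: "nat \<Rightarrow> (nat \<Rightarrow> real) \<Rightarrow> nat set" where
  "kinks n u = {i. 1 \<le> i \<and> i + 1 < n \<and> 2 * u i < u (i + 1) + u (i - 1)}"

lemma finite_kinks: "finite (kinks n u)"
  by (rule finite_subset[of _ "{..<n}"]) (auto simp: kinks_def)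

lemma q_pieces_eq: "q_pieces n u = Suc (card (kinks n u))"
  by (simp add: q_pieces_def kinks_def)

text \<open>Gram--Schmidt applied to the hinges \<open>i \<mapsto> max 0 (i - k)\<close> in decreasing order of \<open>k\<close>;
  each new hinge is nonzero at \<open>k + 1\<close>, where all previous vectors vanish.\<close>

lemma orthonormal_hinges:
  fixes K :: "nat set"
  assumes "finite K" and "\<forall>k\<in>K. Suc k < n"
  shows "\<exists>b :: nat \<Rightarrow> nat \<Rightarrow> real.
      (\<forall>k\<in>K. \<forall>l\<in>K. (\<Sum>i<n. b k i * b l i) = (if k = l then 1 else 0)) \<and>
      (\<forall>k\<in>K. \<forall>i. 1 \<le> i \<and> i \<notin> K \<longrightarrow> 2 * b k i = b k (i + 1) + b k (i - 1))"
proof -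
  \<comment> \<open>The third conjunct is added for the induction: vectors built so far vanish up to
    the least element of \<open>K\<close>, hence at \<open>Suc k\<close> for the next, smaller
    \<open>k\<close>.\<close>
  have "\<exists>b :: nat \<Rightarrow> nat \<Rightarrow> real.
      (\<forall>k\<in>K. \<forall>l\<in>K. (\<Sum>i<n. b k i * b l i) = (if k = l then 1 else 0)) \<and>
      (\<forall>k\<in>K. \<forall>i. 1 \<le> i \<and> i \<notin> K \<longrightarrow> 2 * b k i = b k (i + 1) + b k (i - 1)) \<and>
      (\<forall>k\<in>K. \<forall>i. (\<forall>l\<in>K. i \<le> l) \<longrightarrow> b k i = 0)"
    using assms
  proof (induction K rule: finite_linorder_min_induct)
    case empty
    then show ?case by simp
  next
    case (insert k K)
    have "\<forall>k\<in>K. Suc k < n" using insert.prems by blast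
    from insert.IH[OF this] obtain b :: "nat \<Rightarrow> nat \<Rightarrow> real" where
      orth': "\<forall>j\<in>K. \<forall>l\<in>K. (\<Sum>i<n. b j i * b l i) = (if j = l then 1 else 0)" and
      aff': "\<forall>j\<in>K. \<forall>i. 1 \<le> i \<and> i \<notin> K \<longrightarrow> 2 * b j i = b j (i + 1) + b j (i - 1)" and
      van': "\<forall>j\<in>K. \<forall>i. (\<forall>l\<in>K. i \<le> l) \<longrightarrow> b j i = 0"
      by (elim exE conjE)
    have orth: "(\<Sum>i<n. b j i * b l i) = (if j = l then 1 else 0)" if "j \<in> K" "l \<in> K" for j l
      using orth' that by blast
    have aff: "2 * b j i = b j (i + 1) + b j (i - 1)" if "j \<in> K" "1 \<le> i" "i \<notin> K" for i j
      using aff' that by blast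
    have van: "b j i = 0" if "j \<in> K" "\<And>l. l \<in> K \<Longrightarrow> i \<le> l" for i j
      using van' that by blast
    have k: "k \<notin> K" "Suc k < n" using insert by auto
    define g :: "nat \<Rightarrow> real" where "g i = real (i - k)" for i
    define c where "c j = (\<Sum>i<n. g i * b j i)" for j
    define r where "r i = g i - (\<Sum>j\<in>K. c j * b j i)" for i
    define N where "N = sqrt (\<Sum>i<n. (r i)\<^sup>2)"
    have rorth: "(\<Sum>i<n. r i * b l i) = 0" if "l \<in> K" for l
    proof -
      have "(\<Sum>i<n. r i * b l i) = c l - (\<Sum>i<n. \<Sum>j\<in>K. c j * (b j i * b l i))"
        by (simp add: r_def c_def[of l] left_diff_distrib sum_subtractf sum_distrib_right mult.assoc)
      also have "(\<Sum>i<n. \<Sum>j\<in>K. c j * (b j i * b l i)) = (\<Sum>j\<in>K. c j * (\<Sum>i<n. b j i * b l i))"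
        by (subst sum.swap) (simp add: sum_distrib_left)
      also have "\<dots> = (\<Sum>j\<in>K. if j = l then c j else 0)"
        using that orth by (intro sum.cong) auto
      also have "\<dots> = c l" using that insert.hyps(1) by (simp add: sum.delta')
      finally show ?thesis by simp
    qed
    have "b j (Suc k) = 0" if "j \<in> K" for j
      using that insert.hyps(2) by (intro van) (auto simp: Suc_le_eq)
    then have "r (Suc k) = 1" by (simp add: r_def g_def)
    moreover have "(r (Suc k))\<^sup>2 \<le> (\<Sum>i<n. (r i)\<^sup>2)"
      using k by (intro member_le_sum) auto
    ultimately have N2: "1 \<le> (\<Sum>i<n. (r i)\<^sup>2)" by simp
    then have N: "0 < N" "N\<^sup>2 = (\<Sum>i<n. (r i)\<^sup>2)" by (auto simp: N_def)
    have raff: "2 * r i = r (i + 1) + r (i - 1)" if i: "1 \<le> i" "i \<noteq> k" "i \<notin> K" for i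
    proof -
      have "2 * g i = g (i + 1) + g (i - 1)" using i by (auto simp: g_def of_nat_diff)
      moreover have "2 * (\<Sum>j\<in>K. c j * b j i) = (\<Sum>j\<in>K. c j * b j (i + 1)) + (\<Sum>j\<in>K. c j * b j (i - 1))"
        unfolding sum_distrib_left sum.distrib[symmetric]
      proof (intro sum.cong refl)
        fix j assume "j \<in> K"
        have "2 * (c j * b j i) = c j * (2 * b j i)" by simp
        also have "\<dots> = c j * b j (i + 1) + c j * b j (i - 1)"
          by (simp only: aff[OF \<open>j \<in> K\<close> i(1) i(3)] distrib_left)
        finally show "2 * (c j * b j i) = c j * b j (i + 1) + c j * b j (i - 1)" .
      qed
      ultimately show ?thesis by (simp add: r_def)
    qed
    have rvan: "r i = 0" if "i \<le> k" for i
    proof -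
      have "b j i = 0" if "j \<in> K" for j
        using that \<open>i \<le> k\<close> insert.hyps(2) by (intro van) (auto intro: order_trans less_imp_le)
      then show ?thesis using that by (simp add: r_def g_def)
    qed
    define b' where "b' j = (if j = k then (\<lambda>i. r i / N) else b j)" for j
    have kk: "(\<Sum>i<n. r i / N * (r i / N)) = 1"
      using N N2 by (auto simp: power2_eq_square[symmetric] power_divide sum_divide_distrib[symmetric])
    have kl: "(\<Sum>i<n. r i / N * b l i) = 0" "(\<Sum>i<n. b l i * (r i / N)) = 0" if "l \<in> K" for l
      using rorth[OF that] by (simp_all add: sum_divide_distrib[symmetric] mult.commute)
    show ?case
    proof (intro exI[of _ b'] conjI ballI allI impI)
      fix j l assume "j \<in> insert k K" "l \<in> insert k K"
      then show "(\<Sum>i<n. b' j i * b' l i) = (if j = l then 1 else 0)"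
        using k kk kl orth by (auto simp: b'_def)
    next
      fix j i assume "j \<in> insert k K" "1 \<le> i \<and> i \<notin> insert k K"
      then show "2 * b' j i = b' j (i + 1) + b' j (i - 1)"
        using raff[of i] aff[of j i] by (auto simp: b'_def add_divide_distrib[symmetric])
    next
      fix j i assume "j \<in> insert k K" "\<forall>l\<in>insert k K. i \<le> l"
      then show "b' j i = 0" using rvan[of i] van[of j i] by (auto simp: b'_def)
    qed
  qed
  then show ?thesis by (elim exE conjE) (intro exI conjI)
qed

lemma bessel_sum:
  fixes b :: "'a \<Rightarrow> nat \<Rightarrow> real"
  assumes "finite K"
    and "\<And>k l. k \<in> K \<Longrightarrow> l \<in> K \<Longrightarrow> (\<Sum>i<n. b k i * b l i) = (if k = l then 1 else 0)"
  shows "(\<Sum>k\<in>K. (\<Sum>i<n. d i * b k i)\<^sup>2) \<le> (\<Sum>i<n. (d i)\<^sup>2)"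
proof -
  define c where "c k = (\<Sum>i<n. d i * b k i)" for k
  define e where "e i = (\<Sum>k\<in>K. c k * b k i)" for i
  have de: "(\<Sum>i<n. d i * e i) = (\<Sum>k\<in>K. (c k)\<^sup>2)"
  proof -
    have "(\<Sum>i<n. d i * e i) = (\<Sum>i<n. \<Sum>k\<in>K. c k * (d i * b k i))"
      by (simp only: e_def sum_distrib_left mult.left_commute)
    also have "\<dots> = (\<Sum>k\<in>K. c k * (\<Sum>i<n. d i * b k i))"
      by (subst sum.swap) (simp add: sum_distrib_left)
    finally show ?thesis by (simp add: c_def power2_eq_square)
  qed
  have "(\<Sum>i<n. e i * e i) = (\<Sum>i<n. \<Sum>k\<in>K. c k * (e i * b k i))"
  proof (intro sum.cong refl)
    fix i
    have "e i * e i = e i * (\<Sum>k\<in>K. c k * b k i)" by (simp only: e_def)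
    also have "\<dots> = (\<Sum>k\<in>K. c k * (e i * b k i))" by (simp only: sum_distrib_left mult.left_commute)
    finally show "e i * e i = (\<Sum>k\<in>K. c k * (e i * b k i))" .
  qed
  also have "\<dots> = (\<Sum>k\<in>K. c k * (\<Sum>i<n. e i * b k i))"
    by (subst sum.swap) (simp add: sum_distrib_left)
  also have "\<dots> = (\<Sum>k\<in>K. (c k)\<^sup>2)"
  proof (intro sum.cong refl)
    fix k assume k: "k \<in> K"
    have "(\<Sum>i<n. e i * b k i) = (\<Sum>i<n. \<Sum>l\<in>K. c l * (b l i * b k i))"
      by (simp add: e_def sum_distrib_right mult.assoc)
    also have "\<dots> = (\<Sum>l\<in>K. c l * (\<Sum>i<n. b l i * b k i))"
      by (subst sum.swap) (simp add: sum_distrib_left)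
    also have "\<dots> = (\<Sum>l\<in>K. if l = k then c l else 0)"
      using k assms(2) by (intro sum.cong) auto
    also have "\<dots> = c k" using k assms(1) by simp
    finally show "c k * (\<Sum>i<n. e i * b k i) = (c k)\<^sup>2" by (simp add: power2_eq_square)
  qed
  finally have ee: "(\<Sum>i<n. e i * e i) = (\<Sum>k\<in>K. (c k)\<^sup>2)" .
  have "0 \<le> (\<Sum>i<n. (d i - e i)\<^sup>2)" by (intro sum_nonneg) auto
  also have "\<dots> = (\<Sum>i<n. (d i)\<^sup>2 - 2 * (d i * e i) + e i * e i)"
    by (intro sum.cong) (auto simp: power2_eq_square algebra_simps)
  also have "\<dots> = (\<Sum>i<n. (d i)\<^sup>2) - (\<Sum>k\<in>K. (c k)\<^sup>2)"
    using de ee by (simp add: sum.distrib sum_subtractf sum_distrib_left[symmetric])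
  finally show ?thesis by (simp add: c_def)
qed

text \<open>For small \<open>h\<close> the projection of the perturbed vector keeps all kinks, so its displacement has
  the same component in the lineality space as the perturbation itself; the trace of the orthogonal
  projection onto that space counts the pieces.\<close>

lemma proj_convex_difference_quotient_ge:
  fixes y :: "nat \<Rightarrow> real"
  assumes n: "2 \<le> n" and h: "0 < h"
    and gap: "\<And>i. i \<in> kinks n (proj_convex n y) \<Longrightarrow>
      4 * h < proj_convex n y (i + 1) + proj_convex n y (i - 1) - 2 * proj_convex n y i"
  shows "real (q_pieces n (proj_convex n y))
    \<le> (\<Sum>i<n. (proj_convex n (y(i := y i + h)) i - proj_convex n y i) / h)"
proof -
  define p where "p = proj_convex n y"
  \<comment> \<open>Index 0 contributes the hinge \<open>i \<mapsto> i\<close>, so \<open>K\<close>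
    has as many elements as there are pieces. The constants also lie in the lineality space; leaving
    them out merely lowers the count by one dimension.\<close>
  define K where "K = insert 0 (kinks n p)"
  have finK: "finite K" by (simp add: K_def finite_kinks)
  have cardK: "card K = q_pieces n p"
    unfolding K_def q_pieces_eq
    by (rule card_insert_disjoint[OF finite_kinks]) (simp add: kinks_def)
  have Kn: "\<forall>k\<in>K. Suc k < n" using n by (auto simp: K_def kinks_def)
  obtain b :: "nat \<Rightarrow> nat \<Rightarrow> real" where
    orth': "\<forall>k\<in>K. \<forall>l\<in>K. (\<Sum>i<n. b k i * b l i) = (if k = l then 1 else 0)" and
    aff: "\<forall>k\<in>K. \<forall>i. 1 \<le> i \<and> i \<notin> K \<longrightarrow> 2 * b k i = b k (i + 1) + b k (i - 1)"
    using orthonormal_hinges[OF finK Kn] by (elim exE conjE)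
  have orth: "(\<Sum>i<n. b k i * b l i) = (if k = l then 1 else 0)" if "k \<in> K" "l \<in> K" for k l
    using orth' that by blast
  have lin: "lineality n u (b k)" if "k \<in> K" "kinks n p \<subseteq> kinks n u" for k u
    unfolding lineality_def
  proof (intro allI impI)
    fix i assume i: "1 \<le> i \<and> i + 1 < n \<and> 2 * u i = u (i + 1) + u (i - 1)"
    then have "i \<notin> kinks n u" by (simp add: kinks_def)
    then have "i \<notin> K" using that i by (auto simp: K_def)
    then show "2 * b k i = b k (i + 1) + b k (i - 1)" using aff that i by simp
  qed
  \<comment> \<open>Raising coordinate \<open>i\<close> by \<open>h\<close> displaces the projection
    by \<open>d\<close>. In the span of the \<open>b k\<close> this has the component of the
    perturbation, of squared length \<open>h\<^sup>2 * (\<Sum>k\<in>K. (b k i)\<^sup>2)\<close>;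
    Bessel and firm nonexpansiveness bound that by \<open>h * d i\<close>.\<close>
  have main: "h * (\<Sum>k\<in>K. (b k i)\<^sup>2) \<le> proj_convex n (y(i := y i + h)) i - p i" if i: "i < n" for i
  proof -
    define y' where "y' = y(i := y i + h)"
    define z where "z = proj_convex n y'"
    define d where "d j = z j - p j" for j
    have y': "(\<Sum>j<n. (y' j - y j) * f j) = h * f i" for f
    proof -
      have "(\<Sum>j<n. (y' j - y j) * f j) = (\<Sum>j<n. if j = i then h * f j else 0)"
        by (intro sum.cong) (auto simp: y'_def)
      then show ?thesis using i by simp
    qed
    have dist: "\<bar>z j - p j\<bar> \<le> h" if "j < n" for j
    proof -
      have "\<bar>z j - p j\<bar> \<le> (\<Sum>j<n. \<bar>y' j - y j\<bar>)"
        unfolding z_def p_def by (rule proj_convex_coordinate_lipschitz[OF that])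
      also have "\<dots> = (\<Sum>j<n. (y' j - y j) * 1)"
        using h by (intro sum.cong) (auto simp: y'_def)
      finally show ?thesis unfolding y' by simp
    qed
    \<comment> \<open>Each coordinate moves by at most \<open>h\<close>, so a second difference
      moves by at most \<open>h + h + 2 * h\<close>, less than the assumed gap.\<close>
    have "kinks n p \<subseteq> kinks n z"
    proof
      fix j assume j: "j \<in> kinks n p"
      then have j': "1 \<le> j" "j + 1 < n" "j - 1 < n" by (auto simp: kinks_def)
      then show "j \<in> kinks n z"
        using gap[of j] j dist[of j] dist[of "j + 1"] dist[of "j - 1"]
        by (simp add: kinks_def p_def[symmetric] abs_le_iff)
    qed
    \<comment> \<open>As no kink is lost, the \<open>b k\<close> are lineality directions at both
      projections, and both residuals are orthogonal to them.\<close>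
    then have "(\<Sum>j<n. (y' j - z j) * b k j) = 0" "(\<Sum>j<n. (y j - p j) * b k j) = 0" if "k \<in> K" for k
      using lin[OF that] unfolding z_def p_def by (auto intro!: proj_convex_residual_orthogonal)
    then have res: "(\<Sum>j<n. (y' j - z j) * b k j) - (\<Sum>j<n. (y j - p j) * b k j) = 0" if "k \<in> K" for k
      using that by simp
    have dk: "(\<Sum>j<n. d j * b k j) = h * b k i" if "k \<in> K" for k
      using res[OF that] y'[of "b k"] by (simp add: d_def left_diff_distrib sum_subtractf)
    have "h * (h * (\<Sum>k\<in>K. (b k i)\<^sup>2)) = (\<Sum>k\<in>K. (\<Sum>j<n. d j * b k j)\<^sup>2)"
      by (simp add: dk sum_distrib_left power_mult_distrib power2_eq_square mult_ac)
    also have "\<dots> \<le> (\<Sum>j<n. (d j)\<^sup>2)" by (rule bessel_sum[OF finK orth])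
    also have "\<dots> \<le> (\<Sum>j<n. (y' j - y j) * d j)"
      unfolding d_def z_def p_def by (rule proj_convex_firmly_nonexpansive)
    also have "\<dots> = h * d i" by (rule y')
    finally show ?thesis using h by (simp add: d_def z_def y'_def)
  qed
  \<comment> \<open>The trace computed twice: summing over coordinates first counts
    \<open>K\<close>, summing over \<open>K\<close> first gives the terms bounded by
    \<open>main\<close>.\<close>
  have "real (q_pieces n p) = (\<Sum>k\<in>K. \<Sum>i<n. b k i * b k i)"
    using orth by (simp add: cardK[symmetric])
  also have "\<dots> = (\<Sum>i<n. \<Sum>k\<in>K. (b k i)\<^sup>2)"
    by (subst sum.swap) (simp add: power2_eq_square)
  also have "\<dots> \<le> (\<Sum>i<n. (proj_convex n (y(i := y i + h)) i - p i) / h)"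
    using main h by (intro sum_mono) (simp add: field_simps)
  finally show ?thesis by (simp add: p_def)
qed

section \<open>Affine pieces of the mean\<close>

text \<open>The cuts are placed right after each element of \<open>K\<close>. Such an element is
  therefore always the last index of its block and never has both neighbours inside it.\<close>

lemma consecutive_blocks:
  fixes K :: "nat set"
  assumes "finite K" and "\<forall>k\<in>K. Suc k < n" and "0 < n"
  shows "\<exists>t :: nat \<Rightarrow> nat. t 0 = 0 \<and> t (Suc (card K)) = n \<and>
    (\<forall>c\<le>card K. t c < t (Suc c) \<and> t (Suc c) \<le> n \<and> (\<forall>k\<in>K. t c \<le> k \<longrightarrow> t (Suc c) \<le> Suc k))"
  using assms
proof (induction K arbitrary: n rule: finite_linorder_max_induct)
  case empty
  then show ?case by (intro exI[of _ "\<lambda>c. if c = 0 then 0 else n"]) auto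
next
  case (insert k K)
  have "\<forall>l\<in>K. Suc l < Suc k" using insert.hyps by auto
  from insert.IH[OF this zero_less_Suc] obtain t where t: "t 0 = 0" "t (Suc (card K)) = Suc k"
    "\<forall>c\<le>card K. t c < t (Suc c) \<and> t (Suc c) \<le> Suc k \<and> (\<forall>l\<in>K. t c \<le> l \<longrightarrow> t (Suc c) \<le> Suc l)"
    by (elim exE conjE)
  have card: "card (insert k K) = Suc (card K)" using insert.hyps by (subst card_insert_disjoint) auto
  have k: "Suc k < n" using insert.prems by auto
  show ?case unfolding card
  proof (intro exI[of _ "t(Suc (Suc (card K)) := n)"] conjI allI impI)
    fix c assume c: "c \<le> Suc (card K)"
    show "(t(Suc (Suc (card K)) := n)) c < (t(Suc (Suc (card K)) := n)) (Suc c)"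
      using c t k by (cases "c = Suc (card K)") auto
    show "(t(Suc (Suc (card K)) := n)) (Suc c) \<le> n"
    proof (cases "c = Suc (card K)")
      case False
      then have "t (Suc c) \<le> Suc k" using c t(3) by auto
      then show ?thesis using k by simp
    qed simp
    show "\<forall>l\<in>insert k K. (t(Suc (Suc (card K)) := n)) c \<le> l \<longrightarrow> (t(Suc (Suc (card K)) := n)) (Suc c) \<le> Suc l"
      using c t insert.hyps(2) by (cases "c = Suc (card K)") auto
  qed (use t in auto)
qed

lemma sum_consecutive_blocks:
  fixes f :: "nat \<Rightarrow> real" and t :: "nat \<Rightarrow> nat"
  assumes "t 0 = 0" and "\<And>c. c < q \<Longrightarrow> t c \<le> t (Suc c)"
  shows "(\<Sum>i<t q. f i) = (\<Sum>c<q. \<Sum>i<t (Suc c) - t c. f (t c + i))"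
  using assms(2)
proof (induction q)
  case (Suc q)
  have "(\<Sum>i<t (Suc q). f i) = (\<Sum>i<t q. f i) + (\<Sum>i=t q..<t (Suc q). f i)"
    using Suc.prems[of q] sum.atLeastLessThan_concat[of 0 "t q" "t (Suc q)" f] by (simp add: atLeast0LessThan)
  also have "(\<Sum>i=t q..<t (Suc q). f i) = (\<Sum>i<t (Suc q) - t q. f (t q + i))"
    by (subst sum.atLeastLessThan_shift_0) (simp add: atLeast0LessThan)
  finally show ?case using Suc by simp
qed (simp add: assms(1))

lemma sum_mult_square_le:
  fixes a A B :: "'a \<Rightarrow> real"
  assumes "finite C" and "\<And>c. c \<in> C \<Longrightarrow> (a c)\<^sup>2 \<le> A c * B c"
    and "\<And>c. c \<in> C \<Longrightarrow> 0 \<le> A c" and "\<And>c. c \<in> C \<Longrightarrow> 0 \<le> B c"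
  shows "(\<Sum>c\<in>C. a c)\<^sup>2 \<le> (\<Sum>c\<in>C. A c) * (\<Sum>c\<in>C. B c)"
  using assms
proof (induction C rule: finite_induct)
  case (insert c C)
  then show ?case by (simp, intro add_mult_square_le) (auto intro!: sum_nonneg)
qed simp

text \<open>On a block \<mu> is affine, so \<open>v\<close> is convex there and the block estimates
  add up to \<open>\<langle>\<xi>, v\<rangle>\<^sup>2 \<le> E * |v|\<^sup>2\<close>. The variational
  inequality tested with \<mu> gives \<open>|v|\<^sup>2 \<le> \<langle>\<xi>, v\<rangle>\<close>;
  together they leave \<open>\<langle>\<xi>, v\<rangle> \<le> E\<close>.\<close>

lemma noise_inner_proj_le:
  fixes \<mu> \<xi> :: "nat \<Rightarrow> real" and t :: "nat \<Rightarrow> nat"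
  assumes \<mu>: "convex_upto n \<mu>"
    and t: "t 0 = 0" "t (Suc (card (kinks n \<mu>))) = n"
      "\<forall>c\<le>card (kinks n \<mu>). t c < t (Suc c) \<and> t (Suc c) \<le> n \<and>
         (\<forall>k\<in>kinks n \<mu>. t c \<le> k \<longrightarrow> t (Suc c) \<le> Suc k)"
  shows "(\<Sum>i<n. \<xi> i * (proj_convex n (\<lambda>i. \<mu> i + \<xi> i) i - \<mu> i))
    \<le> (\<Sum>c<q_pieces n \<mu>. convex_energy (t (Suc c) - t c) (\<lambda>i. \<xi> (t c + i)))"
proof -
  define p where "p = proj_convex n (\<lambda>i. \<mu> i + \<xi> i)"
  define v where "v i = p i - \<mu> i" for i
  define q where "q = q_pieces n \<mu>"
  define E where "E = (\<Sum>c<q. convex_energy (t (Suc c) - t c) (\<lambda>i. \<xi> (t c + i)))"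
  have tc: "t c < t (Suc c)" "t (Suc c) \<le> n" "\<And>k. k \<in> kinks n \<mu> \<Longrightarrow> t c \<le> k \<Longrightarrow> t (Suc c) \<le> Suc k"
    if "c < q" for c
    using t(3) that by (auto simp: q_def q_pieces_eq)
  have tq: "t q = n" using t(2) by (simp add: q_def q_pieces_eq)
  have block: "convex_upto (t (Suc c) - t c) (\<lambda>i. v (t c + i))" if c: "c < q" for c
    unfolding convex_upto_def
  proof (intro allI impI)
    fix i assume i: "1 \<le> i \<and> i + 1 < t (Suc c) - t c"
    define j where "j = t c + i"
    have j: "1 \<le> j" "j + 1 < n" "t c + (i + 1) = j + 1" "t c + (i - 1) = j - 1"
      using i tc(2)[OF c] by (auto simp: j_def)
    \<comment> \<open>Only the last index of a block can be a kink, and the strict bound on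
      \<open>i + 1\<close> keeps \<open>j\<close> below it.\<close>
    have "j \<notin> kinks n \<mu>" using tc(3)[OF c, of j] i by (auto simp: j_def)
    then have "2 * \<mu> j \<ge> \<mu> (j + 1) + \<mu> (j - 1)" using j by (auto simp: kinks_def)
    moreover have "2 * p j \<le> p (j + 1) + p (j - 1)"
      using proj_convex_upto[of n] j unfolding p_def convex_upto_def by blast
    ultimately show "2 * v (t c + i) \<le> v (t c + (i + 1)) + v (t c + (i - 1))"
      unfolding j j_def[symmetric] by (simp add: v_def)
  qed
  have "(\<Sum>i<n. \<xi> i * v i)\<^sup>2 \<le> E * (\<Sum>c<q. \<Sum>i<t (Suc c) - t c. (v (t c + i))\<^sup>2)"
  proof -
    have "(\<Sum>i<n. \<xi> i * v i) = (\<Sum>c<q. \<Sum>i<t (Suc c) - t c. \<xi> (t c + i) * v (t c + i))"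
      using sum_consecutive_blocks[of t q "\<lambda>i. \<xi> i * v i"] t(1) tc(1) tq less_imp_le by metis
    then show ?thesis unfolding E_def
      by (simp only:) (intro sum_mult_square_le convex_upto_inner_square_le block convex_energy_nonneg sum_nonneg, auto)
  qed
  also have "(\<Sum>c<q. \<Sum>i<t (Suc c) - t c. (v (t c + i))\<^sup>2) = (\<Sum>i<n. (v i)\<^sup>2)"
    using sum_consecutive_blocks[of t q "\<lambda>i. (v i)\<^sup>2"] t(1) tc(1) tq less_imp_le by metis
  finally have sq: "(\<Sum>i<n. \<xi> i * v i)\<^sup>2 \<le> E * (\<Sum>i<n. (v i)\<^sup>2)" .
  have "0 \<ge> (\<Sum>i<n. (\<mu> i + \<xi> i - p i) * (\<mu> i - p i))"
    using proj_convex_variational[OF \<mu>, of "\<lambda>i. \<mu> i + \<xi> i"] by (simp add: p_def)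
  also have "(\<Sum>i<n. (\<mu> i + \<xi> i - p i) * (\<mu> i - p i)) = (\<Sum>i<n. (v i)\<^sup>2) - (\<Sum>i<n. \<xi> i * v i)"
    unfolding sum_subtractf[symmetric] by (intro sum.cong) (auto simp: v_def power2_eq_square algebra_simps)
  finally have vv: "(\<Sum>i<n. (v i)\<^sup>2) \<le> (\<Sum>i<n. \<xi> i * v i)" by simp
  have E0: "0 \<le> E" unfolding E_def by (intro sum_nonneg convex_energy_nonneg)
  have "(\<Sum>i<n. \<xi> i * v i) \<le> E"
  proof (cases "(\<Sum>i<n. \<xi> i * v i) > 0")
    case True
    have "(\<Sum>i<n. \<xi> i * v i) * (\<Sum>i<n. \<xi> i * v i) \<le> E * (\<Sum>i<n. \<xi> i * v i)"
      using sq mult_left_mono[OF vv E0] by (simp add: power2_eq_square)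
    then show ?thesis using True by simp
  qed (use E0 in simp)
  then show ?thesis by (simp add: E_def v_def p_def q_def)
qed

text \<open>Concavity of the logarithm through its tangent at the average length:
  \<open>ln x \<le> x - 1\<close> with \<open>x\<close> the length times \<open>q / n\<close>. The
  linear terms cancel because the lengths add up to \<open>n\<close>.\<close>

lemma sum_ln_block_lengths_le:
  fixes t :: "nat \<Rightarrow> nat"
  assumes "t 0 = 0" and "t q = n" and "\<And>c. c < q \<Longrightarrow> t c < t (Suc c)" and "0 < q"
  shows "(\<Sum>c<q. ln (real (t (Suc c) - t c))) \<le> real q * ln (real n / real q)"
proof -
  have tel: "(\<Sum>c<q. real (t (Suc c) - t c)) = real n"
    using sum_consecutive_blocks[where f = "\<lambda>_. 1" and q = q, OF assms(1) less_imp_le[OF assms(3)]] assms(2)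
    by (simp del: of_nat_diff)
  have "0 < (\<Sum>c<q. real (t (Suc c) - t c))"
    using assms(3,4) by (intro sum_pos) auto
  then have "0 < n" using tel by simp
  have "(\<Sum>c<q. ln (real (t (Suc c) - t c)))
      \<le> (\<Sum>c<q. ln (real n / real q) + (real (t (Suc c) - t c) * (real q / real n) - 1))"
  proof (intro sum_mono)
    fix c assume "c \<in> {..<q}"
    then have m: "0 < real (t (Suc c) - t c)" using assms(3)[of c] by simp
    have "ln (real (t (Suc c) - t c) * (real q / real n)) \<le> real (t (Suc c) - t c) * (real q / real n) - 1"
      using m \<open>0 < n\<close> assms(4) by (intro ln_le_minus_one) auto
    moreover have "ln (real (t (Suc c) - t c) * (real q / real n))
        = ln (real (t (Suc c) - t c)) - ln (real n / real q)"
      using m \<open>0 < n\<close> assms(4) by (subst ln_mult) (auto simp: ln_div simp del: of_nat_diff)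
    ultimately show "ln (real (t (Suc c) - t c))
        \<le> ln (real n / real q) + (real (t (Suc c) - t c) * (real q / real n) - 1)" by linarith
  qed
  also have "\<dots> = real q * ln (real n / real q) + (\<Sum>c<q. real (t (Suc c) - t c)) * (real q / real n) - real q"
    unfolding sum.distrib sum_subtractf sum_distrib_right by simp
  also have "\<dots> = real q * ln (real n / real q)" unfolding tel using \<open>0 < n\<close> by simp
  finally show ?thesis .
qed

section \<open>Stein's lemma in one dimension\<close>

abbreviation gauss :: "real \<Rightarrow> real measure" where
  "gauss \<sigma> \<equiv> density lborel (normal_density 0 \<sigma>)"

lemma integrable_gauss_iff:
  fixes f :: "real \<Rightarrow> real"
  assumes "f \<in> borel_measurable borel"
  shows "integrable (gauss \<sigma>) f \<longleftrightarrow> integrable lborel (\<lambda>x. normal_density 0 \<sigma> x * f x)"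
  using assms by (subst integrable_density) auto

lemma integral_gauss:
  fixes f :: "real \<Rightarrow> real"
  assumes "f \<in> borel_measurable borel"
  shows "(\<integral>x. f x \<partial>gauss \<sigma>) = (\<integral>x. normal_density 0 \<sigma> x * f x \<partial>lborel)"
  using assms by (subst integral_density) auto

lemma gauss_moments:
  assumes "0 < \<sigma>"
  shows "integrable (gauss \<sigma>) (\<lambda>x. x)" and "integrable (gauss \<sigma>) (\<lambda>x. x\<^sup>2)"
    and "(\<integral>x. x \<partial>gauss \<sigma>) = 0" and "(\<integral>x. x\<^sup>2 \<partial>gauss \<sigma>) = \<sigma>\<^sup>2"
  using integrable_normal_moment[OF assms, of 0 1] integrable_normal_moment[OF assms, of 0 2]
    integral_normal_moment_nz_1[OF assms, of 0] integral_normal_moment_even[OF assms, of 0 1]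
  by (simp_all add: integrable_gauss_iff integral_gauss)

lemma lipschitz_isCont:
  fixes f :: "real \<Rightarrow> real"
  assumes "\<And>x y. \<bar>f x - f y\<bar> \<le> \<bar>x - y\<bar>"
  shows "isCont f x"
proof -
  have "(\<lambda>y. f y - f x) \<midarrow>x\<rightarrow> 0"
  proof (rule Lim_null_comparison)
    show "\<forall>\<^sub>F y in at x. norm (f y - f x) \<le> \<bar>y - x\<bar>"
      using assms by (intro always_eventually) auto
    show "(\<lambda>y. \<bar>y - x\<bar>) \<midarrow>x\<rightarrow> 0" by (auto intro!: tendsto_eq_intros)
  qed
  then show ?thesis by (simp add: isCont_def LIM_zero_iff)
qed

text \<open>Stein's identity is exact for the moving average \<open>F\<close> of \<open>f\<close> over \<open>[x, x + h]\<close>, whose derivative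
  is the difference quotient of \<open>f\<close>, and \<open>F\<close> differs from \<open>f\<close> by at most \<open>h\<close>.\<close>

lemma gauss_difference_quotient_le:
  fixes f :: "real \<Rightarrow> real"
  assumes \<sigma>: "0 < \<sigma>" and h: "0 < h" and lip: "\<And>x y. \<bar>f x - f y\<bar> \<le> \<bar>x - y\<bar>"
  shows "0 \<le> (\<integral>x. (x * f x + h * \<bar>x\<bar>) / \<sigma>\<^sup>2 - (f (x + h) - f x) / h \<partial>gauss \<sigma>)"
proof -
  note cont = lipschitz_isCont[OF lip]
  have cont_on: "continuous_on UNIV f" using cont by (simp add: continuous_on_eq_continuous_at)
  have [measurable]: "f \<in> borel_measurable borel"
    by (rule borel_measurable_continuous_onI[OF cont_on])
  define \<phi> where "\<phi> = normal_density 0 \<sigma>"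
  have [measurable]: "\<phi> \<in> borel_measurable borel" by (simp add: \<phi>_def)
  have \<phi>0: "0 \<le> \<phi> x" for x by (simp add: \<phi>_def)
  obtain G where G: "\<And>x. (G has_real_derivative f x) (at x)"
    using einterval_antiderivative[of "-\<infinity>" \<infinity> f] cont
    by (auto simp: has_real_derivative_iff_has_vector_derivative)
  define F where "F x = (G (x + h) - G x) / h" for x
  define D where "D x = (f (x + h) - f x) / h" for x
  have F': "(F has_real_derivative D x) (at x)" for x
  proof -
    have "((\<lambda>x. G (x + h)) has_real_derivative f (x + h)) (at x)"
      using DERIV_shift[of G "f (x + h)" x h] G by blast
    then show ?thesis unfolding F_def D_def by (intro DERIV_cdivide DERIV_diff G)
  qed
  have Ff: "\<bar>F x - f x\<bar> \<le> h" for x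
  proof -
    obtain z where z: "x < z" "z < x + h" "G (x + h) - G x = (x + h - x) * f z"
      using MVT2[of x "x + h" G f] h G by auto
    then have "F x = f z" using h by (simp add: F_def)
    then show ?thesis using lip[of z x] z by simp
  qed
  have F_cont: "isCont F x" for x using F' by (rule DERIV_isCont)
  have [measurable]: "F \<in> borel_measurable borel"
    using F_cont by (intro borel_measurable_continuous_onI) (simp add: continuous_on_eq_continuous_at)
  have [measurable]: "D \<in> borel_measurable borel" unfolding D_def[abs_def] by measurable
  \<comment> \<open>A common constant of linear growth for \<open>f\<close> and \<open>F\<close>; it
    yields integrability against the Gaussian weight and decay at infinity.\<close>
  define C where "C = \<bar>f 0\<bar> + h"
  have Fb: "\<bar>F x\<bar> \<le> C + \<bar>x\<bar>" for x using Ff[of x] lip[of x 0] by (simp add: C_def)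
  have fb: "\<bar>f x\<bar> \<le> C + \<bar>x\<bar>" for x using lip[of x 0] h by (simp add: C_def)
  have Db: "\<bar>D x\<bar> \<le> 1" for x using lip[of "x + h" x] h by (simp add: D_def)
  have i0: "integrable lborel (\<lambda>x. \<phi> x)" and i1: "integrable lborel (\<lambda>x. \<phi> x * \<bar>x\<bar>)"
    and i2: "integrable lborel (\<lambda>x. \<phi> x * \<bar>x\<bar>^2)"
    using integrable_normal_moment_abs[OF \<sigma>, of 0 1] integrable_normal_moment_abs[OF \<sigma>, of 0 2] \<sigma>
    by (simp_all add: \<phi>_def)
  have xg: "integrable lborel (\<lambda>x. \<phi> x * (x * g x))"
    if [measurable]: "g \<in> borel_measurable borel" and g: "\<And>x. \<bar>g x\<bar> \<le> C + \<bar>x\<bar>" for g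
  proof (rule Bochner_Integration.integrable_bound)
    show "integrable lborel (\<lambda>x. C * (\<phi> x * \<bar>x\<bar>) + \<phi> x * \<bar>x\<bar>^2)"
      using i1 i2 by auto
    have "\<phi> x * (\<bar>x\<bar> * \<bar>g x\<bar>) \<le> \<phi> x * (\<bar>x\<bar> * (C + \<bar>x\<bar>))" for x
      using \<phi>0 g by (intro mult_left_mono) auto
    then have "norm (\<phi> x * (x * g x)) \<le> C * (\<phi> x * \<bar>x\<bar>) + \<phi> x * \<bar>x\<bar>^2" for x
      using \<phi>0[of x] by (simp add: abs_mult power2_eq_square algebra_simps)
    then show "AE x in lborel. norm (\<phi> x * (x * g x)) \<le> norm (C * (\<phi> x * \<bar>x\<bar>) + \<phi> x * \<bar>x\<bar>^2)"
      by (intro always_eventually allI) (metis abs_ge_self order_trans real_norm_def)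
  qed simp
  have iF: "integrable lborel (\<lambda>x. \<phi> x * (x * F x))" and if': "integrable lborel (\<lambda>x. \<phi> x * (x * f x))"
    using Fb fb by (intro xg; simp)+
  have iD: "integrable lborel (\<lambda>x. \<phi> x * D x)"
    using \<phi>0 Db by (intro Bochner_Integration.integrable_bound[OF i0]) (auto simp: abs_mult mult_left_le)
  have \<phi>': "(\<phi> has_real_derivative - (x / \<sigma>\<^sup>2) * \<phi> x) (at x)" for x
    unfolding \<phi>_def normal_density_def using \<sigma>
    by (auto intro!: derivative_eq_intros simp: field_simps power2_eq_square)
  have lim: "((\<lambda>x. F x * \<phi> x) \<longlongrightarrow> 0) B" if "B = at_top \<or> B = at_bot" for B
  proof (rule Lim_null_comparison)
    show "\<forall>\<^sub>F x in B. norm (F x * \<phi> x) \<le> (C + \<bar>x\<bar>) * \<phi> x"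
      using Fb \<phi>0 by (intro always_eventually allI) (auto simp: abs_mult intro!: mult_right_mono)
    have "((\<lambda>x. (C + \<bar>x\<bar>) * \<phi> x) \<longlongrightarrow> 0) at_top" "((\<lambda>x. (C + \<bar>x\<bar>) * \<phi> x) \<longlongrightarrow> 0) at_bot"
      unfolding \<phi>_def normal_density_def using \<sigma> by real_asymp+
    then show "((\<lambda>x. (C + \<bar>x\<bar>) * \<phi> x) \<longlongrightarrow> 0) B" using that by auto
  qed
  \<comment> \<open>The integrand is the derivative of \<open>F * \<phi>\<close>, which vanishes at
    both ends; this is Stein's identity for \<open>F\<close>.\<close>
  have "(LBINT x=-\<infinity>..\<infinity>. \<phi> x * D x - \<phi> x * (x * F x) / \<sigma>\<^sup>2) = 0 - 0"
  proof (rule interval_integral_FTC_integrable)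
    fix x :: real
    show "((\<lambda>x. F x * \<phi> x) has_vector_derivative \<phi> x * D x - \<phi> x * (x * F x) / \<sigma>\<^sup>2) (at x)"
      unfolding has_real_derivative_iff_has_vector_derivative[symmetric]
      by (rule derivative_eq_intros F' \<phi>' refl)+ (simp add: field_simps)
    show "isCont (\<lambda>x. \<phi> x * D x - \<phi> x * (x * F x) / \<sigma>\<^sup>2) x"
      unfolding D_def using \<sigma> h
      by (intro continuous_intros F_cont DERIV_isCont[OF \<phi>'] isCont_o2[OF _ cont] cont) auto
  next
    show "set_integrable lborel (einterval (-\<infinity>) \<infinity>) (\<lambda>x. \<phi> x * D x - \<phi> x * (x * F x) / \<sigma>\<^sup>2)"
      using iD iF by (simp add: set_integrable_def)
  qed (use lim in \<open>auto simp: ereal_tendsto_simps1\<close>)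
  then have "(\<integral>x. \<phi> x * D x - \<phi> x * (x * F x) / \<sigma>\<^sup>2 \<partial>lborel) = 0"
    by (simp add: interval_lebesgue_integral_def set_lebesgue_integral_def)
  then have "(\<integral>x. \<phi> x * D x \<partial>lborel) = (\<integral>x. \<phi> x * (x * F x) \<partial>lborel) / \<sigma>\<^sup>2"
    using iD iF by simp
  also have "\<dots> \<le> ((\<integral>x. \<phi> x * (x * f x) \<partial>lborel) + h * (\<integral>x. \<phi> x * \<bar>x\<bar> \<partial>lborel)) / \<sigma>\<^sup>2"
  proof (intro divide_right_mono)
    have "(\<integral>x. \<phi> x * (x * F x) \<partial>lborel) \<le> (\<integral>x. \<phi> x * (x * f x) + h * (\<phi> x * \<bar>x\<bar>) \<partial>lborel)"
    proof (intro integral_mono)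
      fix x
      have "x * F x - x * f x \<le> \<bar>x\<bar> * \<bar>F x - f x\<bar>"
        by (metis abs_ge_self abs_mult right_diff_distrib)
      also have "\<dots> \<le> \<bar>x\<bar> * h" using Ff by (intro mult_left_mono) auto
      finally have "\<phi> x * (x * F x) \<le> \<phi> x * (x * f x + \<bar>x\<bar> * h)"
        using \<phi>0 by (intro mult_left_mono) auto
      then show "\<phi> x * (x * F x) \<le> \<phi> x * (x * f x) + h * (\<phi> x * \<bar>x\<bar>)"
        by (simp add: algebra_simps)
    qed (use iF if' i1 in auto)
    then show "(\<integral>x. \<phi> x * (x * F x) \<partial>lborel)
        \<le> (\<integral>x. \<phi> x * (x * f x) \<partial>lborel) + h * (\<integral>x. \<phi> x * \<bar>x\<bar> \<partial>lborel)"
      using if' i1 by simp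
  qed simp
  finally have "0 \<le> (\<integral>x. (\<phi> x * (x * f x) + h * (\<phi> x * \<bar>x\<bar>)) / \<sigma>\<^sup>2 - \<phi> x * D x \<partial>lborel)"
    using iD if' i1 by simp
  also have "\<dots> = (\<integral>x. \<phi> x * ((x * f x + h * \<bar>x\<bar>) / \<sigma>\<^sup>2 - D x) \<partial>lborel)"
    by (simp add: algebra_simps add_divide_distrib)
  finally show ?thesis unfolding D_def \<phi>_def by (subst integral_gauss) auto
qed

section \<open>Gaussian noise\<close>

lemma prob_space_noise: "0 < \<sigma> \<Longrightarrow> prob_space (noise_measure n \<sigma>)"
  unfolding noise_measure_def by (intro prob_space_PiM prob_space_normal_density)

lemma noise_component_measurable:
  "i < n \<Longrightarrow> (\<lambda>\<xi>. \<xi> i) \<in> borel_measurable (noise_measure n \<sigma>)"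
proof -
  assume "i < n"
  then have "(\<lambda>\<xi>. \<xi> i) \<in> measurable (noise_measure n \<sigma>) (gauss \<sigma>)"
    unfolding noise_measure_def by simp
  also have "measurable (noise_measure n \<sigma>) (gauss \<sigma>) = borel_measurable (noise_measure n \<sigma>)"
    by (intro measurable_cong_sets) auto
  finally show ?thesis .
qed

lemma noise_component_integral:
  fixes g :: "real \<Rightarrow> real"
  assumes "0 < \<sigma>" "i < n" "integrable (gauss \<sigma>) g"
  shows "integrable (noise_measure n \<sigma>) (\<lambda>\<xi>. g (\<xi> i))"
    and "(\<integral>\<xi>. g (\<xi> i) \<partial>noise_measure n \<sigma>) = (\<integral>x. g x \<partial>gauss \<sigma>)"
proof -
  have d: "distr (noise_measure n \<sigma>) (gauss \<sigma>) (\<lambda>\<xi>. \<xi> i) = gauss \<sigma>"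
    unfolding noise_measure_def using assms
    by (intro distr_PiM_component[of "{..<n}" "\<lambda>_. gauss \<sigma>"] prob_space_normal_density) auto
  have m: "(\<lambda>\<xi>. \<xi> i) \<in> measurable (noise_measure n \<sigma>) (gauss \<sigma>)"
    unfolding noise_measure_def using assms(2) by simp
  show "integrable (noise_measure n \<sigma>) (\<lambda>\<xi>. g (\<xi> i))"
    using integrable_distr[OF m, of g] assms(3) unfolding d by blast
  show "(\<integral>\<xi>. g (\<xi> i) \<partial>noise_measure n \<sigma>) = (\<integral>x. g x \<partial>gauss \<sigma>)"
    using integral_distr[OF m, of g] assms(3) unfolding d by simp
qed

lemma noise_integral_split:
  fixes f :: "(nat \<Rightarrow> real) \<Rightarrow> real"
  assumes "0 < \<sigma>" "i < n" "integrable (noise_measure n \<sigma>) f"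
  shows "(\<integral>\<xi>. f \<xi> \<partial>noise_measure n \<sigma>)
    = (\<integral>z. (\<integral>x. f (z(i := x)) \<partial>gauss \<sigma>) \<partial>PiM ({..<n} - {i}) (\<lambda>_. gauss \<sigma>))"
proof -
  interpret N: prob_space "gauss \<sigma>" by (rule prob_space_normal_density[OF assms(1)])
  interpret product_sigma_finite "\<lambda>_. gauss \<sigma>" by standard
  have "insert i ({..<n} - {i}) = {..<n}" using assms(2) by auto
  then show ?thesis
    using product_integral_insert[of "{..<n} - {i}" i f] assms(3) by (simp add: noise_measure_def)
qed

section \<open>Second moments of the noise and of the quadratic form\<close>

lemma noise_product_integrable:
  assumes "0 < \<sigma>" "i < n" "j < n"
  shows "integrable (noise_measure n \<sigma>) (\<lambda>\<xi>. \<xi> i * \<xi> j)"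
proof (rule Bochner_Integration.integrable_bound)
  show "integrable (noise_measure n \<sigma>) (\<lambda>\<xi>. (\<xi> i)\<^sup>2 + (\<xi> j)\<^sup>2)"
    using assms by (intro Bochner_Integration.integrable_add noise_component_integral gauss_moments)
  show "(\<lambda>\<xi>. \<xi> i * \<xi> j) \<in> borel_measurable (noise_measure n \<sigma>)"
    using assms by (intro borel_measurable_times noise_component_measurable)
  have "\<bar>\<xi> i * \<xi> j\<bar> \<le> (\<xi> i)\<^sup>2 + (\<xi> j)\<^sup>2" for \<xi> :: "nat \<Rightarrow> real"
  proof -
    have "2 * (\<bar>\<xi> i\<bar> * \<bar>\<xi> j\<bar>) \<le> (\<xi> i)\<^sup>2 + (\<xi> j)\<^sup>2"
      using sum_squares_bound[of "\<bar>\<xi> i\<bar>" "\<bar>\<xi> j\<bar>"] by simp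
    moreover have "0 \<le> \<bar>\<xi> i\<bar> * \<bar>\<xi> j\<bar>" by simp
    ultimately show ?thesis unfolding abs_mult by linarith
  qed
  then show "AE \<xi> in noise_measure n \<sigma>. norm (\<xi> i * \<xi> j) \<le> norm ((\<xi> i)\<^sup>2 + (\<xi> j)\<^sup>2)"
    by (intro always_eventually allI) (metis abs_ge_self order_trans real_norm_def)
qed

lemma noise_covariance:
  assumes "0 < \<sigma>" "i < n" "j < n"
  shows "(\<integral>\<xi>. \<xi> i * \<xi> j \<partial>noise_measure n \<sigma>) = (if i = j then \<sigma>\<^sup>2 else 0)"
proof (cases "i = j")
  case True
  then show ?thesis
    using noise_component_integral(2)[OF assms(1,2), of "\<lambda>x. x\<^sup>2"] gauss_moments[OF assms(1)]
    by (simp add: power2_eq_square)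
next
  case False
  then show ?thesis
    using noise_integral_split[OF assms(1,2) noise_product_integrable[OF assms]] gauss_moments[OF assms(1)]
    by simp
qed

lemma noise_sum_product:
  assumes "0 < \<sigma>" "A \<subseteq> {..<n}" "B \<subseteq> {..<n}"
  shows "integrable (noise_measure n \<sigma>) (\<lambda>\<xi>. (\<Sum>i\<in>A. \<xi> i) * (\<Sum>j\<in>B. \<xi> j))"
    and "(\<integral>\<xi>. (\<Sum>i\<in>A. \<xi> i) * (\<Sum>j\<in>B. \<xi> j) \<partial>noise_measure n \<sigma>) = \<sigma>\<^sup>2 * real (card (A \<inter> B))"
proof -
  have fin: "finite A" "finite B" using assms finite_subset by blast+
  have int: "integrable (noise_measure n \<sigma>) (\<lambda>\<xi>. \<xi> i * \<xi> j)" if "i \<in> A" "j \<in> B" for i j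
    using assms that by (intro noise_product_integrable) auto
  then show "integrable (noise_measure n \<sigma>) (\<lambda>\<xi>. (\<Sum>i\<in>A. \<xi> i) * (\<Sum>j\<in>B. \<xi> j))"
    unfolding sum_product by (intro Bochner_Integration.integrable_sum)
  have "(\<integral>\<xi>. (\<Sum>i\<in>A. \<xi> i) * (\<Sum>j\<in>B. \<xi> j) \<partial>noise_measure n \<sigma>)
      = (\<Sum>i\<in>A. \<Sum>j\<in>B. \<integral>\<xi>. \<xi> i * \<xi> j \<partial>noise_measure n \<sigma>)"
    unfolding sum_product using int
    by (subst Bochner_Integration.integral_sum)
      (auto intro!: sum.cong Bochner_Integration.integral_sum Bochner_Integration.integrable_sum)
  also have "\<dots> = (\<Sum>i\<in>A. \<Sum>j\<in>B. if i = j then \<sigma>\<^sup>2 else 0)"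
    using assms by (intro sum.cong refl noise_covariance) auto
  also have "\<dots> = (\<Sum>i\<in>A. if i \<in> B then \<sigma>\<^sup>2 else 0)"
    using fin by (intro sum.cong) auto
  also have "\<dots> = \<sigma>\<^sup>2 * real (card (A \<inter> B))"
    using fin by (simp add: sum.If_cases)
  finally show "(\<integral>\<xi>. (\<Sum>i\<in>A. \<xi> i) * (\<Sum>j\<in>B. \<xi> j) \<partial>noise_measure n \<sigma>) = \<sigma>\<^sup>2 * real (card (A \<inter> B))" .
qed

text \<open>For the \<open>k\<close> indices \<open>A\<close> chosen inside the block
  \<open>B\<close> the expectation is \<open>\<sigma>\<^sup>2 * (k - k\<^sup>2 / m)\<close>, as
  \<open>A \<inter> B = A\<close>: centring only reduces it. The injection \<open>f\<close> allows
  the block to be read in either direction.\<close>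

lemma noise_centred_sum_square:
  fixes f :: "nat \<Rightarrow> nat"
  assumes \<sigma>: "0 < \<sigma>" and B: "B \<subseteq> {..<n}" "card B = m" "0 < m"
    and f: "inj_on f {..<k}" "f ` {..<k} \<subseteq> B"
  shows "integrable (noise_measure n \<sigma>) (\<lambda>\<xi>. (\<Sum>i<k. \<xi> (f i) - (\<Sum>j\<in>B. \<xi> j) / real m)\<^sup>2)" (is "integrable _ ?g")
    and "(\<integral>\<xi>. (\<Sum>i<k. \<xi> (f i) - (\<Sum>j\<in>B. \<xi> j) / real m)\<^sup>2 \<partial>noise_measure n \<sigma>) \<le> \<sigma>\<^sup>2 * real k"
proof -
  define A where "A = f ` {..<k}"
  define r where "r = real k / real m"
  have A: "A \<subseteq> B" "card A = k" "A \<inter> B = A" using f by (auto simp: A_def card_image)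
  have A': "A \<subseteq> {..<n}" using A(1) B(1) by simp
  define X where "X C \<xi> = (\<Sum>i\<in>C. \<xi> i)" for C and \<xi> :: "nat \<Rightarrow> real"
  have eq: "?g = (\<lambda>\<xi>. X A \<xi> * X A \<xi> - 2 * r * (X A \<xi> * X B \<xi>) + r\<^sup>2 * (X B \<xi> * X B \<xi>))"
  proof
    fix \<xi> :: "nat \<Rightarrow> real"
    have "(\<Sum>i<k. \<xi> (f i) - (\<Sum>j\<in>B. \<xi> j) / real m) = X A \<xi> - r * X B \<xi>"
      using f(1) by (simp add: X_def A_def r_def sum.reindex sum_subtractf)
    then show "?g \<xi> = X A \<xi> * X A \<xi> - 2 * r * (X A \<xi> * X B \<xi>) + r\<^sup>2 * (X B \<xi> * X B \<xi>)"
      by (simp only:) (simp add: power2_eq_square algebra_simps)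
  qed
  note [simp] = noise_sum_product(1)[OF \<sigma> A' A', folded X_def] noise_sum_product(1)[OF \<sigma> A' B(1), folded X_def]
    noise_sum_product(1)[OF \<sigma> B(1) B(1), folded X_def]
  show "integrable (noise_measure n \<sigma>) ?g" unfolding eq by simp
  have "(\<integral>\<xi>. ?g \<xi> \<partial>noise_measure n \<sigma>) = \<sigma>\<^sup>2 * real k - 2 * r * (\<sigma>\<^sup>2 * real k) + r\<^sup>2 * (\<sigma>\<^sup>2 * real m)"
    unfolding eq
    using noise_sum_product(2)[OF \<sigma> A' A', folded X_def] noise_sum_product(2)[OF \<sigma> A' B(1), folded X_def]
      noise_sum_product(2)[OF \<sigma> B(1) B(1), folded X_def] A B by simp
  also have "\<dots> = \<sigma>\<^sup>2 * real k - \<sigma>\<^sup>2 * (real k)\<^sup>2 / real m"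
    using B(3) by (simp add: r_def power2_eq_square field_simps)
  also have "\<dots> \<le> \<sigma>\<^sup>2 * real k" by simp
  finally show "(\<integral>\<xi>. ?g \<xi> \<partial>noise_measure n \<sigma>) \<le> \<sigma>\<^sup>2 * real k" .
qed

lemma harm_le_ln: "0 < m \<Longrightarrow> harm m \<le> 1 + ln (real m)"
  using decseqD[OF decseq_harm_diff_ln, of 0 "m - 1"] by (simp add: harm_def)

text \<open>The mean term contributes \<open>\<sigma>\<^sup>2\<close>. Each partial mean energy
  contributes at most \<open>\<sigma>\<^sup>2\<close> times the sum of \<open>j / j\<^sup>2\<close>,
  a harmonic number bounded by \<open>1 + ln m\<close>. Hence the factor
  \<open>1 + 4 * 2 * (1 + ln m)\<close>.\<close>

lemma noise_convex_energy:
  assumes \<sigma>: "0 < \<sigma>" and m: "0 < m" "a + m \<le> n"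
  shows "integrable (noise_measure n \<sigma>) (\<lambda>\<xi>. convex_energy m (\<lambda>i. \<xi> (a + i)))"
    and "(\<integral>\<xi>. convex_energy m (\<lambda>i. \<xi> (a + i)) \<partial>noise_measure n \<sigma>) \<le> \<sigma>\<^sup>2 * (9 + 8 * ln (real m))"
proof -
  define B where "B = (+) a ` {..<m}"
  have B: "B \<subseteq> {..<n}" "card B = m" using m by (auto simp: B_def card_image)
  have XB: "(\<Sum>i<m. \<xi> (a + i)) = (\<Sum>j\<in>B. \<xi> j)" for \<xi> :: "nat \<Rightarrow> real"
    by (simp add: B_def sum.reindex)
  have pme: "integrable (noise_measure n \<sigma>) (\<lambda>\<xi>. partial_mean_energy m (\<lambda>i. centred m (\<lambda>i. \<xi> (a + i)) (g i))) \<and>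
      (\<integral>\<xi>. partial_mean_energy m (\<lambda>i. centred m (\<lambda>i. \<xi> (a + i)) (g i)) \<partial>noise_measure n \<sigma>) \<le> \<sigma>\<^sup>2 * harm m"
    if g: "inj_on g {..<m}" "g ` {..<m} \<subseteq> {..<m}" for g :: "nat \<Rightarrow> nat"
  proof -
    define f where "f i = a + g i" for i
    have f: "inj_on f {..<Suc j}" "f ` {..<Suc j} \<subseteq> B" if "j < m" for j
    proof -
      show "inj_on f {..<Suc j}"
        using that by (auto simp: f_def inj_on_def intro!: inj_onD[OF g(1)])
      show "f ` {..<Suc j} \<subseteq> B" using g(2) that by (auto simp: f_def B_def image_subset_iff intro!: imageI)
    qed
    define h where "h j \<xi> = (\<Sum>i<Suc j. \<xi> (f i) - (\<Sum>j\<in>B. \<xi> j) / real m)\<^sup>2" for j and \<xi> :: "nat \<Rightarrow> real"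
    have eq: "partial_mean_energy m (\<lambda>i. centred m (\<lambda>i. \<xi> (a + i)) (g i))
        = (\<Sum>j<m. h j \<xi> / (real (Suc j))\<^sup>2)" for \<xi> :: "nat \<Rightarrow> real"
      unfolding partial_mean_energy_def centred_def h_def XB f_def power_divide ..
    have h: "integrable (noise_measure n \<sigma>) (h j)" "(\<integral>\<xi>. h j \<xi> \<partial>noise_measure n \<sigma>) \<le> \<sigma>\<^sup>2 * real (Suc j)"
      if "j < m" for j
      unfolding h_def using noise_centred_sum_square[OF \<sigma> B m(1) f[OF that]] by blast+
    have "(\<integral>\<xi>. (\<Sum>j<m. h j \<xi> / (real (Suc j))\<^sup>2) \<partial>noise_measure n \<sigma>)
        = (\<Sum>j<m. (\<integral>\<xi>. h j \<xi> \<partial>noise_measure n \<sigma>) / (real (Suc j))\<^sup>2)"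
      using h(1) by (subst Bochner_Integration.integral_sum) auto
    also have "\<dots> \<le> (\<Sum>j<m. \<sigma>\<^sup>2 * real (Suc j) / (real (Suc j))\<^sup>2)"
      using h(2) by (intro sum_mono divide_right_mono) auto
    also have "\<dots> = \<sigma>\<^sup>2 * (\<Sum>j<m. inverse (real (Suc j)))"
      unfolding sum_distrib_left by (intro sum.cong) (auto simp: power2_eq_square divide_inverse simp del: of_nat_Suc)
    also have "(\<Sum>j<m. inverse (real (Suc j))) = harm m"
      unfolding harm_def by (rule sum.reindex_bij_witness[of _ "\<lambda>j. j - 1" Suc]) auto
    finally show ?thesis unfolding eq using h(1) by (auto intro!: Bochner_Integration.integrable_sum integrable_divide)
  qed
  have id: "inj_on (\<lambda>i. i) {..<m}" "(\<lambda>i. i) ` {..<m} \<subseteq> {..<m}" by auto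
  have rv: "inj_on (\<lambda>i. m - Suc i) {..<m}" "(\<lambda>i. m - Suc i) ` {..<m} \<subseteq> {..<m}"
    by (auto simp: inj_on_def)
  have sq: "integrable (noise_measure n \<sigma>) (\<lambda>\<xi>. (\<Sum>i<m. \<xi> (a + i))\<^sup>2)"
    "(\<integral>\<xi>. (\<Sum>i<m. \<xi> (a + i))\<^sup>2 \<partial>noise_measure n \<sigma>) = \<sigma>\<^sup>2 * real m"
    unfolding XB power2_eq_square using noise_sum_product[OF \<sigma> B(1) B(1)] B(2) by (auto simp: power2_eq_square)
  note [simp] = sq conjunct1[OF pme[OF id]] conjunct1[OF pme[OF rv]]
  show "integrable (noise_measure n \<sigma>) (\<lambda>\<xi>. convex_energy m (\<lambda>i. \<xi> (a + i)))"
    unfolding convex_energy_def by simp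
  have "(\<integral>\<xi>. convex_energy m (\<lambda>i. \<xi> (a + i)) \<partial>noise_measure n \<sigma>)
      \<le> \<sigma>\<^sup>2 * real m / real m + 4 * (\<sigma>\<^sup>2 * harm m + \<sigma>\<^sup>2 * harm m)"
    unfolding convex_energy_def using conjunct2[OF pme[OF id]] conjunct2[OF pme[OF rv]]
    by (simp add: mult.commute)
  also have "\<dots> = \<sigma>\<^sup>2 * (1 + 8 * harm m)" using m by (simp add: algebra_simps)
  also have "\<dots> \<le> \<sigma>\<^sup>2 * (9 + 8 * ln (real m))"
    using harm_le_ln[OF m(1)] by (intro mult_left_mono) auto
  finally show "(\<integral>\<xi>. convex_energy m (\<lambda>i. \<xi> (a + i)) \<partial>noise_measure n \<sigma>) \<le> \<sigma>\<^sup>2 * (9 + 8 * ln (real m))" .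
qed

section \<open>Measurability and integrability of the projection\<close>

lemma proj_convex_cong:
  assumes "\<And>i. i < n \<Longrightarrow> y i = z i" shows "proj_convex n y = proj_convex n z"
proof -
  have "(\<Sum>i<n. (y i - u i)\<^sup>2) = (\<Sum>i<n. (z i - u i)\<^sup>2)" for u :: "nat \<Rightarrow> real"
    using assms by (intro sum.cong) auto
  then show ?thesis unfolding proj_convex_def by simp
qed

lemma proj_convex_coordinate_continuous:
  assumes "i < n"
  shows "continuous_on UNIV (\<lambda>y. proj_convex n y i)"
  unfolding continuous_on_eq_continuous_at[OF open_UNIV] isCont_def
proof
  fix y :: "nat \<Rightarrow> real"
  have "((\<lambda>z. proj_convex n z i - proj_convex n y i) \<longlongrightarrow> 0) (at y)"
  proof (rule Lim_null_comparison)
    show "\<forall>\<^sub>F z in at y. norm (proj_convex n z i - proj_convex n y i) \<le> (\<Sum>j<n. \<bar>z j - y j\<bar>)"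
      using proj_convex_coordinate_lipschitz[OF assms] by (intro always_eventually) simp
    have "((\<lambda>z. z j) \<longlongrightarrow> y j) (at y)" for j
    proof -
      have "continuous_on UNIV (\<lambda>z :: nat \<Rightarrow> real. z j)" by (rule continuous_on_product_coordinates)
      then show ?thesis unfolding continuous_on_eq_continuous_at[OF open_UNIV] isCont_def by blast
    qed
    then have "((\<lambda>z. \<Sum>j<n. \<bar>z j - y j\<bar>) \<longlongrightarrow> (\<Sum>j<n. \<bar>y j - y j\<bar>)) (at y)"
      by (intro tendsto_intros)
    then show "((\<lambda>z. \<Sum>j<n. \<bar>z j - y j\<bar>) \<longlongrightarrow> 0) (at y)" by simp
  qed
  then show "((\<lambda>z. proj_convex n z i) \<longlongrightarrow> proj_convex n y i) (at y)" by (simp add: LIM_zero_iff)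
qed

text \<open>Padding the argument by zero beyond \<open>n\<close> leaves the projection unchanged and
  makes the argument measurable into the full product space, where the coordinate of the projection
  is continuous and hence Borel.\<close>

lemma proj_convex_coordinate_measurable:
  assumes "i < n" and "\<And>j. j < n \<Longrightarrow> (\<lambda>\<xi>. y \<xi> j) \<in> borel_measurable M"
  shows "(\<lambda>\<xi>. proj_convex n (y \<xi>) i) \<in> borel_measurable M"
proof -
  have "(\<lambda>\<xi>. \<lambda>j. if j < n then y \<xi> j else 0) \<in> borel_measurable M"
  proof (rule measurable_coordinatewise_then_product)
    fix j show "(\<lambda>\<xi>. if j < n then y \<xi> j else 0) \<in> borel_measurable M"
      using assms(2)[of j] by (cases "j < n") auto
  qed
  from measurable_compose[OF this borel_measurable_continuous_onI[OF proj_convex_coordinate_continuous[OF assms(1)]]]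
  have "(\<lambda>\<xi>. proj_convex n (\<lambda>j. if j < n then y \<xi> j else 0) i) \<in> borel_measurable M" .
  moreover have "proj_convex n (\<lambda>j. if j < n then y \<xi> j else 0) = proj_convex n (y \<xi>)" for \<xi>
    by (rule proj_convex_cong) simp
  ultimately show ?thesis by simp
qed

lemma noise_proj_integrable:
  assumes \<sigma>: "0 < \<sigma>" and i: "i < n"
  shows "integrable (noise_measure n \<sigma>) (\<lambda>\<xi>. \<xi> i * proj_convex n (\<lambda>j. \<mu> j + \<xi> j) i)"
proof (rule Bochner_Integration.integrable_bound)
  define C where "C = \<bar>proj_convex n \<mu> i\<bar>"
  show "integrable (noise_measure n \<sigma>) (\<lambda>\<xi>. C * \<bar>\<xi> i\<bar> + (\<Sum>j<n. \<bar>\<xi> i * \<xi> j\<bar>))"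
    using noise_component_integral(1)[OF \<sigma> i gauss_moments(1)[OF \<sigma>]] noise_product_integrable[OF \<sigma> i]
    by (intro Bochner_Integration.integrable_add Bochner_Integration.integrable_sum integrable_mult_right integrable_abs) auto
  show "(\<lambda>\<xi>. \<xi> i * proj_convex n (\<lambda>j. \<mu> j + \<xi> j) i) \<in> borel_measurable (noise_measure n \<sigma>)"
    using i by (intro borel_measurable_times noise_component_measurable proj_convex_coordinate_measurable
        borel_measurable_add borel_measurable_const)
  have "\<bar>\<xi> i * proj_convex n (\<lambda>j. \<mu> j + \<xi> j) i\<bar> \<le> C * \<bar>\<xi> i\<bar> + (\<Sum>j<n. \<bar>\<xi> i * \<xi> j\<bar>)" for \<xi>
  proof -
    have "\<bar>proj_convex n (\<lambda>j. \<mu> j + \<xi> j) i\<bar> \<le> C + (\<Sum>j<n. \<bar>\<xi> j\<bar>)"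
      using proj_convex_coordinate_lipschitz[OF i, of "\<lambda>j. \<mu> j + \<xi> j" \<mu>] by (simp add: C_def)
    then have "\<bar>\<xi> i\<bar> * \<bar>proj_convex n (\<lambda>j. \<mu> j + \<xi> j) i\<bar> \<le> \<bar>\<xi> i\<bar> * (C + (\<Sum>j<n. \<bar>\<xi> j\<bar>))"
      by (intro mult_left_mono) auto
    then show ?thesis by (simp add: abs_mult sum_distrib_left algebra_simps)
  qed
  then show "AE \<xi> in noise_measure n \<sigma>. norm (\<xi> i * proj_convex n (\<lambda>j. \<mu> j + \<xi> j) i)
      \<le> norm (C * \<bar>\<xi> i\<bar> + (\<Sum>j<n. \<bar>\<xi> i * \<xi> j\<bar>))"
    by (intro always_eventually allI) (metis abs_ge_self order_trans real_norm_def)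
qed

section \<open>Stein's inequality for the projection\<close>

lemma proj_convex_coordinate_difference:
  assumes "i < n" "0 < h"
  shows "\<bar>(proj_convex n (y(i := y i + h)) i - proj_convex n y i) / h\<bar> \<le> 1"
proof -
  have "(\<Sum>j<n. \<bar>(y(i := y i + h)) j - y j\<bar>) = (\<Sum>j<n. if j = i then h else 0)"
    using assms by (intro sum.cong) auto
  then show ?thesis
    using proj_convex_coordinate_lipschitz[OF assms(1), of "y(i := y i + h)" y] assms by simp
qed

text \<open>With all noise coordinates but the \<open>i\<close>-th frozen, the projected coordinate
  is a 1-Lipschitz function of one real variable, to which the one-dimensional inequality applies;
  Fubini then integrates over the others.\<close>

lemma noise_difference_quotient:
  fixes \<mu> :: "nat \<Rightarrow> real"
  assumes \<sigma>: "0 < \<sigma>" and i: "i < n" and h: "0 < h"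
  defines "f \<equiv> \<lambda>\<xi>. proj_convex n (\<lambda>j. \<mu> j + \<xi> j) i"
    and "D \<equiv> \<lambda>\<xi>. (proj_convex n ((\<lambda>j. \<mu> j + \<xi> j)(i := \<mu> i + \<xi> i + h)) i - proj_convex n (\<lambda>j. \<mu> j + \<xi> j) i) / h"
  shows "integrable (noise_measure n \<sigma>) D"
    and "(\<integral>\<xi>. D \<xi> \<partial>noise_measure n \<sigma>)
      \<le> ((\<integral>\<xi>. \<xi> i * f \<xi> \<partial>noise_measure n \<sigma>) + h * (\<integral>x. \<bar>x\<bar> \<partial>gauss \<sigma>)) / \<sigma>\<^sup>2"
proof -
  interpret prob_space "noise_measure n \<sigma>" by (rule prob_space_noise[OF \<sigma>])
  have "(\<lambda>\<xi>. ((\<lambda>j. \<mu> j + \<xi> j)(i := \<mu> i + \<xi> i + h)) j) \<in> borel_measurable (noise_measure n \<sigma>)" if "j < n" for j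
    using that by (cases "j = i") (auto intro!: borel_measurable_add noise_component_measurable)
  then have "D \<in> borel_measurable (noise_measure n \<sigma>)"
    unfolding D_def using i
    by (intro borel_measurable_divide borel_measurable_diff borel_measurable_const proj_convex_coordinate_measurable
        borel_measurable_add noise_component_measurable)
  moreover have "\<bar>D \<xi>\<bar> \<le> 1" for \<xi>
    using proj_convex_coordinate_difference[OF i h, of "\<lambda>j. \<mu> j + \<xi> j"] by (simp add: D_def)
  ultimately show iD: "integrable (noise_measure n \<sigma>) D"
    by (intro integrable_const_bound[of _ 1]) auto
  have abs: "integrable (gauss \<sigma>) (\<lambda>x. \<bar>x\<bar>)" using gauss_moments(1)[OF \<sigma>] by (rule integrable_abs)
  have "integrable (noise_measure n \<sigma>) (\<lambda>\<xi>. \<xi> i * f \<xi>)"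
    unfolding f_def by (rule noise_proj_integrable[OF \<sigma> i])
  note ints = this noise_component_integral(1)[OF \<sigma> i abs] iD
  \<comment> \<open>The whole inequality is put into one integrable function, so that Fubini applies
    once and only the sign of each slice integral matters.\<close>
  define H where "H \<xi> = (\<xi> i * f \<xi> + h * \<bar>\<xi> i\<bar>) / \<sigma>\<^sup>2 - D \<xi>" for \<xi>
  have iH: "integrable (noise_measure n \<sigma>) H" unfolding H_def using ints by auto
  have "0 \<le> (\<integral>x. H (z(i := x)) \<partial>gauss \<sigma>)" for z
  proof -
    define g where "g x = f (z(i := x))" for x
    have lip: "\<bar>g x - g y\<bar> \<le> \<bar>x - y\<bar>" for x y
    proof -
      have "\<bar>g x - g y\<bar> \<le> (\<Sum>j<n. \<bar>(\<mu> j + (z(i := x)) j) - (\<mu> j + (z(i := y)) j)\<bar>)"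
        unfolding g_def f_def by (rule proj_convex_coordinate_lipschitz[OF i])
      also have "\<dots> = (\<Sum>j<n. if j = i then \<bar>x - y\<bar> else 0)" by (intro sum.cong) auto
      finally show ?thesis using i by simp
    qed
    have "(\<lambda>j. \<mu> j + (z(i := x)) j)(i := \<mu> i + (z(i := x)) i + h) = (\<lambda>j. \<mu> j + (z(i := x + h)) j)" for x
      by (auto simp: fun_eq_iff)
    then have "H (z(i := x)) = (x * g x + h * \<bar>x\<bar>) / \<sigma>\<^sup>2 - (g (x + h) - g x) / h" for x
      unfolding H_def D_def g_def f_def by simp
    then show ?thesis using gauss_difference_quotient_le[OF \<sigma> h lip] by simp
  qed
  then have "0 \<le> (\<integral>\<xi>. H \<xi> \<partial>noise_measure n \<sigma>)"
    unfolding noise_integral_split[OF \<sigma> i iH] by (intro integral_nonneg_AE) auto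
  also have "\<dots> = ((\<integral>\<xi>. \<xi> i * f \<xi> \<partial>noise_measure n \<sigma>) + h * (\<integral>x. \<bar>x\<bar> \<partial>gauss \<sigma>)) / \<sigma>\<^sup>2
      - (\<integral>\<xi>. D \<xi> \<partial>noise_measure n \<sigma>)"
    unfolding H_def using ints noise_component_integral(2)[OF \<sigma> i abs] by simp
  finally show "(\<integral>\<xi>. D \<xi> \<partial>noise_measure n \<sigma>)
      \<le> ((\<integral>\<xi>. \<xi> i * f \<xi> \<partial>noise_measure n \<sigma>) + h * (\<integral>x. \<bar>x\<bar> \<partial>gauss \<sigma>)) / \<sigma>\<^sup>2" by simp
qed

lemma q_pieces_le: "1 \<le> n \<Longrightarrow> q_pieces n u \<le> n"
proof -
  assume "1 \<le> n"
  have "card (kinks n u) \<le> card {1..<n}" by (intro card_mono) (auto simp: kinks_def)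
  then show ?thesis using \<open>1 \<le> n\<close> by (simp add: q_pieces_eq)
qed

lemma noise_pieces_integrable:
  assumes \<sigma>: "0 < \<sigma>" and n: "1 \<le> n"
  shows "integrable (noise_measure n \<sigma>) (\<lambda>\<xi>. real (q_pieces n (proj_convex n (\<lambda>i. \<mu> i + \<xi> i))))"
proof -
  interpret prob_space "noise_measure n \<sigma>" by (rule prob_space_noise[OF \<sigma>])
  have [measurable]: "(\<lambda>\<xi>. proj_convex n (\<lambda>i. \<mu> i + \<xi> i) j) \<in> borel_measurable (noise_measure n \<sigma>)" if "j < n" for j
    using that by (intro proj_convex_coordinate_measurable borel_measurable_add borel_measurable_const
        noise_component_measurable)
  have eq: "real (q_pieces n u) = 1 + (\<Sum>i = 1..<n - 1. if 2 * u i < u (i + 1) + u (i - 1) then 1 else 0)" for u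
  proof -
    have "kinks n u = {i \<in> {1..<n - 1}. 2 * u i < u (i + 1) + u (i - 1)}"
      by (auto simp: kinks_def)
    then show ?thesis by (simp add: q_pieces_eq sum.If_cases Int_def)
  qed
  have "(\<lambda>\<xi>. real (q_pieces n (proj_convex n (\<lambda>i. \<mu> i + \<xi> i)))) \<in> borel_measurable (noise_measure n \<sigma>)"
    unfolding eq
    by (intro borel_measurable_add borel_measurable_const borel_measurable_sum measurable_If
        borel_measurable_pred_less borel_measurable_times) auto
  then show ?thesis
    using q_pieces_le[OF n] by (intro integrable_const_bound[of _ "real n"]) auto
qed

text \<open>The bound by difference quotients holds once \<open>h\<close> is small relative to the
  gaps at the kinks, which depend on \<xi>. Therefore \<open>h\<close> runs through a null sequence
  and dominated convergence gives the limit.\<close>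

lemma expected_pieces_le_noise_inner:
  assumes \<sigma>: "0 < \<sigma>" and n: "2 \<le> n"
  shows "\<sigma>\<^sup>2 * (\<integral>\<xi>. real (q_pieces n (proj_convex n (\<lambda>i. \<mu> i + \<xi> i))) \<partial>noise_measure n \<sigma>)
    \<le> (\<integral>\<xi>. (\<Sum>i<n. \<xi> i * proj_convex n (\<lambda>j. \<mu> j + \<xi> j) i) \<partial>noise_measure n \<sigma>)"
proof -
  interpret prob_space "noise_measure n \<sigma>" by (rule prob_space_noise[OF \<sigma>])
  have int: "integrable (noise_measure n \<sigma>) (\<lambda>\<xi>. real (q_pieces n (proj_convex n (\<lambda>i. \<mu> i + \<xi> i))))"
    using noise_pieces_integrable[OF \<sigma>] n by simp
  define q where "q \<xi> = real (q_pieces n (proj_convex n (\<lambda>i. \<mu> i + \<xi> i)))" for \<xi>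
  define h where "h k = 1 / real (Suc k)" for k
  define D where "D k i \<xi> = (proj_convex n ((\<lambda>j. \<mu> j + \<xi> j)(i := \<mu> i + \<xi> i + h k)) i
    - proj_convex n (\<lambda>j. \<mu> j + \<xi> j) i) / h k" for k i \<xi>
  define S where "S k \<xi> = (\<Sum>i<n. D k i \<xi>)" for k \<xi>
  define I where "I = (\<integral>\<xi>. (\<Sum>i<n. \<xi> i * proj_convex n (\<lambda>j. \<mu> j + \<xi> j) i) \<partial>noise_measure n \<sigma>)"
  define A where "A = (\<integral>x. \<bar>x\<bar> \<partial>gauss \<sigma>)"
  have h: "0 < h k" for k by (simp add: h_def)
  have h0: "h \<longlonglongrightarrow> 0" unfolding h_def by (rule LIMSEQ_Suc[OF lim_1_over_n])
  note iD = noise_difference_quotient(1)[OF \<sigma> _ h, of _ n \<mu>, folded D_def]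
  have iS: "integrable (noise_measure n \<sigma>) (S k)" for k
    unfolding S_def using iD by (intro Bochner_Integration.integrable_sum) auto
  have ES: "(\<integral>\<xi>. S k \<xi> \<partial>noise_measure n \<sigma>) \<le> (I + real n * h k * A) / \<sigma>\<^sup>2" for k
  proof -
    have "(\<integral>\<xi>. S k \<xi> \<partial>noise_measure n \<sigma>) = (\<Sum>i<n. \<integral>\<xi>. D k i \<xi> \<partial>noise_measure n \<sigma>)"
      unfolding S_def using iD by (intro Bochner_Integration.integral_sum) auto
    also have "\<dots> \<le> (\<Sum>i<n. ((\<integral>\<xi>. \<xi> i * proj_convex n (\<lambda>j. \<mu> j + \<xi> j) i \<partial>noise_measure n \<sigma>) + h k * A) / \<sigma>\<^sup>2)"
      unfolding A_def D_def using h by (intro sum_mono noise_difference_quotient(2)[OF \<sigma>]) auto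
    also have "\<dots> = (I + real n * h k * A) / \<sigma>\<^sup>2"
      unfolding I_def sum_divide_distrib[symmetric] sum.distrib
      by (subst Bochner_Integration.integral_sum) (auto intro: noise_proj_integrable[OF \<sigma>])
    finally show ?thesis .
  qed
  \<comment> \<open>Truncation at \<open>q\<close> turns the eventual lower bound
    \<open>q \<xi> \<le> S k \<xi>\<close> into eventual equality, whether or not \<open>S k\<close>
    converges.\<close>
  have conv: "(\<lambda>k. min (S k \<xi>) (q \<xi>)) \<longlonglongrightarrow> q \<xi>" for \<xi>
  proof (rule tendsto_eventually)
    define p where "p = proj_convex n (\<lambda>i. \<mu> i + \<xi> i)"
    have "\<forall>\<^sub>F k in sequentially. \<forall>i\<in>kinks n p. 4 * h k < p (i + 1) + p (i - 1) - 2 * p i"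
    proof (intro eventually_ball_finite finite_kinks ballI)
      fix i assume "i \<in> kinks n p"
      then have "0 < p (i + 1) + p (i - 1) - 2 * p i" by (simp add: kinks_def)
      moreover have "(\<lambda>k. 4 * h k) \<longlonglongrightarrow> 0" using tendsto_mult_right_zero[OF h0] by simp
      ultimately show "\<forall>\<^sub>F k in sequentially. 4 * h k < p (i + 1) + p (i - 1) - 2 * p i"
        by (intro order_tendstoD(2))
    qed
    then show "\<forall>\<^sub>F k in sequentially. min (S k \<xi>) (q \<xi>) = q \<xi>"
    proof eventually_elim
      case (elim k)
      have "q \<xi> \<le> S k \<xi>"
        unfolding q_def S_def D_def using elim h
        by (intro proj_convex_difference_quotient_ge[OF n]) (auto simp: p_def)
      then show ?case by simp
    qed
  qed
  have "(\<lambda>k. \<integral>\<xi>. min (S k \<xi>) (q \<xi>) \<partial>noise_measure n \<sigma>) \<longlonglongrightarrow> (\<integral>\<xi>. q \<xi> \<partial>noise_measure n \<sigma>)"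
  proof (rule integral_dominated_convergence[where w = "\<lambda>_. real n"])
    show "q \<in> borel_measurable (noise_measure n \<sigma>)" using int unfolding q_def by simp
    then show "(\<lambda>\<xi>. min (S k \<xi>) (q \<xi>)) \<in> borel_measurable (noise_measure n \<sigma>)" for k
      using iS[of k] by (intro borel_measurable_min) auto
    have q: "0 \<le> q \<xi>" "q \<xi> \<le> real n" for \<xi> using n by (auto simp: q_def intro: q_pieces_le)
    have "\<bar>S k \<xi>\<bar> \<le> real n" for k \<xi>
    proof -
      have "\<bar>S k \<xi>\<bar> \<le> (\<Sum>i<n. \<bar>D k i \<xi>\<bar>)" unfolding S_def by (rule sum_abs)
      also have "\<dots> \<le> (\<Sum>i<n. 1)"
        unfolding D_def using h
        by (intro sum_mono proj_convex_coordinate_difference[where y = "\<lambda>j. \<mu> j + \<xi> j"]) auto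
      finally show ?thesis by simp
    qed
    then have "\<bar>min (S k \<xi>) (q \<xi>)\<bar> \<le> real n" for k \<xi>
      using q[of \<xi>] by (simp add: min_def abs_le_iff)
    then show "AE \<xi> in noise_measure n \<sigma>. norm (min (S k \<xi>) (q \<xi>)) \<le> real n" for k by simp
  qed (use conv in auto)
  moreover have "(\<lambda>k. (I + real n * h k * A) / \<sigma>\<^sup>2) \<longlonglongrightarrow> (I + real n * 0 * A) / \<sigma>\<^sup>2"
    using \<sigma> by (intro tendsto_intros h0) auto
  moreover have "(\<integral>\<xi>. min (S k \<xi>) (q \<xi>) \<partial>noise_measure n \<sigma>) \<le> (I + real n * h k * A) / \<sigma>\<^sup>2" for k
  proof -
    have "(\<integral>\<xi>. min (S k \<xi>) (q \<xi>) \<partial>noise_measure n \<sigma>) \<le> (\<integral>\<xi>. S k \<xi> \<partial>noise_measure n \<sigma>)"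
      using iS int by (intro integral_mono Bochner_Integration.integrable_min) (auto simp: q_def)
    then show ?thesis using ES[of k] by linarith
  qed
  ultimately have "(\<integral>\<xi>. q \<xi> \<partial>noise_measure n \<sigma>) \<le> (I + real n * 0 * A) / \<sigma>\<^sup>2"
    by (intro LIMSEQ_le) auto
  then show ?thesis using \<sigma> by (simp add: q_def I_def field_simps)
qed

text \<open>The noise is centred, so subtracting \<mu> from the projection leaves the expectation
  unchanged; the pathwise bound by block energies then applies, and concavity combines the block
  lengths.\<close>

lemma expected_noise_inner_le:
  assumes \<sigma>: "0 < \<sigma>" and n: "1 \<le> n" and \<mu>: "convex_upto n \<mu>"
  shows "(\<integral>\<xi>. (\<Sum>i<n. \<xi> i * proj_convex n (\<lambda>j. \<mu> j + \<xi> j) i) \<partial>noise_measure n \<sigma>)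
    \<le> \<sigma>\<^sup>2 * (real (q_pieces n \<mu>) * (9 + 8 * ln (real n / real (q_pieces n \<mu>))))"
proof -
  define q where "q = q_pieces n \<mu>"
  have "\<forall>k\<in>kinks n \<mu>. Suc k < n" by (simp add: kinks_def)
  from consecutive_blocks[OF finite_kinks this] n obtain t where t: "t 0 = 0" "t (Suc (card (kinks n \<mu>))) = n"
      "\<forall>c\<le>card (kinks n \<mu>). t c < t (Suc c) \<and> t (Suc c) \<le> n \<and>
         (\<forall>k\<in>kinks n \<mu>. t c \<le> k \<longrightarrow> t (Suc c) \<le> Suc k)"
    by (auto simp: Suc_le_eq)
  have tq: "t q = n" "0 < q" using t(2) by (auto simp: q_def q_pieces_eq)
  have tc: "t c < t (Suc c)" "t (Suc c) \<le> n" if "c < q" for c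
    using t(3) that by (auto simp: q_def q_pieces_eq)
  have energy: "integrable (noise_measure n \<sigma>) (\<lambda>\<xi>. convex_energy (t (Suc c) - t c) (\<lambda>i. \<xi> (t c + i)))"
    "(\<integral>\<xi>. convex_energy (t (Suc c) - t c) (\<lambda>i. \<xi> (t c + i)) \<partial>noise_measure n \<sigma>)
      \<le> \<sigma>\<^sup>2 * (9 + 8 * ln (real (t (Suc c) - t c)))" if "c < q" for c
    using tc[OF that] by (intro noise_convex_energy[OF \<sigma>]; simp)+
  have i\<mu>: "integrable (noise_measure n \<sigma>) (\<lambda>\<xi>. \<xi> i * \<mu> i)" "(\<integral>\<xi>. \<xi> i * \<mu> i \<partial>noise_measure n \<sigma>) = 0"
    if "i < n" for i
    using noise_component_integral[OF \<sigma> that gauss_moments(1)[OF \<sigma>]] gauss_moments(3)[OF \<sigma>] by auto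
  have "(\<integral>\<xi>. (\<Sum>i<n. \<xi> i * \<mu> i) \<partial>noise_measure n \<sigma>) = (\<Sum>i<n. \<integral>\<xi>. \<xi> i * \<mu> i \<partial>noise_measure n \<sigma>)"
    by (rule Bochner_Integration.integral_sum) (simp only: i\<mu> lessThan_iff)
  also have "\<dots> = 0" by (rule sum.neutral) (use i\<mu>(2) in blast)
  finally have \<mu>0: "(\<integral>\<xi>. (\<Sum>i<n. \<xi> i * \<mu> i) \<partial>noise_measure n \<sigma>) = 0" .
  have "(\<integral>\<xi>. (\<Sum>i<n. \<xi> i * proj_convex n (\<lambda>j. \<mu> j + \<xi> j) i) \<partial>noise_measure n \<sigma>)
      = (\<integral>\<xi>. (\<Sum>i<n. \<xi> i * (proj_convex n (\<lambda>j. \<mu> j + \<xi> j) i - \<mu> i)) \<partial>noise_measure n \<sigma>)"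
    unfolding right_diff_distrib sum_subtractf
    using i\<mu> noise_proj_integrable[OF \<sigma>, of _ n \<mu>]
    by (subst Bochner_Integration.integral_diff) (auto simp only: \<mu>0 lessThan_iff diff_zero intro!: Bochner_Integration.integrable_sum)
  also have "\<dots> \<le> (\<integral>\<xi>. (\<Sum>c<q. convex_energy (t (Suc c) - t c) (\<lambda>i. \<xi> (t c + i))) \<partial>noise_measure n \<sigma>)"
    unfolding right_diff_distrib
    using energy(1) i\<mu>(1) noise_proj_integrable[OF \<sigma>, of _ n \<mu>] noise_inner_proj_le[OF \<mu> t]
    by (intro integral_mono Bochner_Integration.integrable_sum Bochner_Integration.integrable_diff)
      (auto simp: q_def right_diff_distrib)
  also have "\<dots> = (\<Sum>c<q. \<integral>\<xi>. convex_energy (t (Suc c) - t c) (\<lambda>i. \<xi> (t c + i)) \<partial>noise_measure n \<sigma>)"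
    using energy(1) by (intro Bochner_Integration.integral_sum) auto
  also have "\<dots> \<le> (\<Sum>c<q. \<sigma>\<^sup>2 * (9 + 8 * ln (real (t (Suc c) - t c))))"
    using energy(2) by (intro sum_mono) auto
  also have "\<dots> = \<sigma>\<^sup>2 * (9 * real q + 8 * (\<Sum>c<q. ln (real (t (Suc c) - t c))))"
    by (simp add: sum_distrib_left[symmetric] sum.distrib)
  also have "\<dots> \<le> \<sigma>\<^sup>2 * (9 * real q + 8 * (real q * ln (real n / real q)))"
    using sum_ln_block_lengths_le[of t q n] t(1) tq tc by (intro mult_left_mono add_left_mono) auto
  finally show ?thesis by (simp add: q_def algebra_simps)
qed

text \<open>For \<open>n \<ge> 2\<close> the preceding bounds give
  \<open>9 * q + 8 * (q * l)\<close>; since \<open>q \<ge> 1\<close> and \<open>l \<ge> 0\<close>,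
  this is at most \<open>10 * q + 10 * (q * l) - 1\<close>.\<close>

lemma expected_pieces_le:
  assumes n: "1 \<le> n" and \<sigma>: "0 < \<sigma>" and \<mu>: "\<mu> \<in> convex_seqs n"
  shows "(\<integral>\<xi>. real (q_pieces n (proj_convex n (\<lambda>i. \<mu> i + \<xi> i))) \<partial>noise_measure n \<sigma>)
    \<le> 10 * real (q_pieces n \<mu>) * ln (exp 1 * real n / real (q_pieces n \<mu>)) - 1"
proof -
  interpret prob_space "noise_measure n \<sigma>" by (rule prob_space_noise[OF \<sigma>])
  define q where "q = q_pieces n \<mu>"
  define l where "l = ln (real n / real q)"
  have q: "1 \<le> real q" "real q \<le> real n"
    using q_pieces_le[OF n, of \<mu>] by (auto simp: q_def q_pieces_eq)
  have l: "0 \<le> l" unfolding l_def using q by (intro ln_ge_zero) auto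
  have "ln (exp 1 * real n / real q) = ln (exp 1 * (real n / real q))" by simp
  also have "\<dots> = 1 + l" using q by (subst ln_mult) (auto simp: l_def)
  finally have rhs: "10 * real q * ln (exp 1 * real n / real q) - 1 = 10 * real q + 10 * (real q * l) - 1"
    by (simp add: algebra_simps)
  have ql: "0 \<le> real q * l" using q l by simp
  have "(\<integral>\<xi>. real (q_pieces n (proj_convex n (\<lambda>i. \<mu> i + \<xi> i))) \<partial>noise_measure n \<sigma>)
      \<le> 10 * real q + 10 * (real q * l) - 1"
  \<comment> \<open>The hinge at 0 needs a second coordinate, so \<open>n = 1\<close> is separate;
    there the number of pieces is constantly 1.\<close>
  proof (cases "n = 1")
    case True
    then have "q_pieces n u = 1" for u by (simp add: q_pieces_def)
    then show ?thesis using q ql by (simp add: prob_space)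
  next
    case False
    then have n2: "2 \<le> n" using n by simp
    have "\<sigma>\<^sup>2 * (\<integral>\<xi>. real (q_pieces n (proj_convex n (\<lambda>i. \<mu> i + \<xi> i))) \<partial>noise_measure n \<sigma>)
        \<le> \<sigma>\<^sup>2 * (real q * (9 + 8 * l))"
      using expected_pieces_le_noise_inner[OF \<sigma> n2, of \<mu>] expected_noise_inner_le[OF \<sigma> n, of \<mu>] \<mu>
      unfolding q_def l_def by (simp add: convex_seqs_iff)
    then have "(\<integral>\<xi>. real (q_pieces n (proj_convex n (\<lambda>i. \<mu> i + \<xi> i))) \<partial>noise_measure n \<sigma>)
        \<le> real q * (9 + 8 * l)"
      using \<sigma> by simp
    also have "\<dots> = 9 * real q + 8 * (real q * l)" by (simp add: algebra_simps)
    finally show ?thesis using q ql by linarith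
  qed
  then show ?thesis using rhs by (simp add: q_def)
qed

theorem mainTheorem9:
  fixes n :: nat and \<sigma> :: real and \<mu> :: "nat \<Rightarrow> real"
  assumes "n \<ge> 1" and "\<sigma> > 0" and "\<mu> \<in> convex_seqs n"
  shows "(\<integral>\<xi>. real (q_pieces n (proj_convex n (\<lambda>i. \<mu> i + \<xi> i))) \<partial>noise_measure n \<sigma>)
           \<le> 10 * real (q_pieces n \<mu>) * ln (exp 1 * real n / real (q_pieces n \<mu>)) - 1
       \<and> (\<forall>\<alpha>::real. 0 < \<alpha> \<and> \<alpha> < 1 \<longrightarrow>
           (\<integral>\<xi>. \<sigma>\<^sup>2 * real (q_pieces n (proj_convex n (\<lambda>i. \<mu> i + \<xi> i)))
                   * (20 + 40 * ln (real n) + 10 * ln (1 / \<alpha>)) / real n \<partial>noise_measure n \<sigma>)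
           \<le> \<sigma>\<^sup>2 * real (q_pieces n \<mu>) * 10 * ln (exp 1 * real n)
                * (20 + 40 * ln (real n) + 10 * ln (1 / \<alpha>)) / real n)"
proof (intro conjI allI impI)
  show bound: "(\<integral>\<xi>. real (q_pieces n (proj_convex n (\<lambda>i. \<mu> i + \<xi> i))) \<partial>noise_measure n \<sigma>)
      \<le> 10 * real (q_pieces n \<mu>) * ln (exp 1 * real n / real (q_pieces n \<mu>)) - 1"
    by (rule expected_pieces_le[OF assms])
  fix \<alpha> :: real assume \<alpha>: "0 < \<alpha> \<and> \<alpha> < 1"
  \<comment> \<open>The deterministic factor between the number of pieces and the statistic; its
    logarithms are nonnegative because \<open>n \<ge> 1\<close> and
    \<open>\<alpha> < 1\<close>.\<close>
  define c where "c = \<sigma>\<^sup>2 * (20 + 40 * ln (real n) + 10 * ln (1 / \<alpha>)) / real n"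
  have c: "0 \<le> c"
    unfolding c_def using assms(1) \<alpha> by (intro divide_nonneg_nonneg mult_nonneg_nonneg add_nonneg_nonneg) auto
  have q: "1 \<le> real (q_pieces n \<mu>)" by (simp add: q_pieces_eq)
  \<comment> \<open>The second bound is coarser than the first: the number of pieces is at least 1
    and is dropped from the logarithm, and the \<open>- 1\<close> is given away.\<close>
  have "ln (exp 1 * real n / real (q_pieces n \<mu>)) \<le> ln (exp 1 * real n)"
    using assms(1) q by (subst ln_le_cancel_iff) (auto simp: divide_le_eq)
  then have "10 * real (q_pieces n \<mu>) * ln (exp 1 * real n / real (q_pieces n \<mu>))
      \<le> 10 * real (q_pieces n \<mu>) * ln (exp 1 * real n)"
    by (intro mult_left_mono) auto
  then have "c * (\<integral>\<xi>. real (q_pieces n (proj_convex n (\<lambda>i. \<mu> i + \<xi> i))) \<partial>noise_measure n \<sigma>)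
      \<le> c * (10 * real (q_pieces n \<mu>) * ln (exp 1 * real n))"
    using bound by (intro mult_left_mono[OF _ c]) linarith
  then show "(\<integral>\<xi>. \<sigma>\<^sup>2 * real (q_pieces n (proj_convex n (\<lambda>i. \<mu> i + \<xi> i)))
          * (20 + 40 * ln (real n) + 10 * ln (1 / \<alpha>)) / real n \<partial>noise_measure n \<sigma>)
      \<le> \<sigma>\<^sup>2 * real (q_pieces n \<mu>) * 10 * ln (exp 1 * real n)
          * (20 + 40 * ln (real n) + 10 * ln (1 / \<alpha>)) / real n"
    unfolding c_def integral_mult_right_zero[symmetric] by (simp add: mult_ac)
qed

end
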